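(* Let $K$ and $L$ be compact lines, with $L$ separable. A continuous increasing surjection $\phi:K\to L$ has the $c_0$-extension property if and only if the following condition holds: for every $G_\delta$ subset $C$ of $L$, if every point of $C$ is an internal point of $L$, then $C\cap Q(\phi)=C\cap Q_0(\phi)$ is countable.
   Context: A compact line is a linearly ordered set which is compact in its order topology. "Increasing" means order-preserving in the weak sense ($s\le t$ implies $\phi(s)\le\phi(t)$). "Countable" means finite or countably infinite. For a compact Hausdorff space $K$, $C(K)$ is the Banach space of continuous real-valued functions on $K$ with the supremum norm. A closed subspace $Y$ of a Banach space $X$ has the $c_0$-extension property in $X$ if every bounded operator $Y\to c_0$ admits a bounded extension $X\to c_0$. For a continuous increasing surjection $\phi:K\to L$ between compact lines, let $\phi^*:C(L)\to C(K)$, $\phi^*(f)=f\circ\phi$, with range $\phi^*C(L)$; $\phi$ is said to have the $c_0$-extension property if $\phi^*C(L)$ has the $c_0$-extension property in $C(K)$. A point $x$ of a linearly ordered set $X$ is internal if it is neither the minimum nor the maximum of $X$, for every $y\in X$ with $y>x$ the interval $]x,y[$ is nonempty, and for every $y\in X$ with $y<x$ the interval $]y,x[$ is nonempty. Define $Q(\phi)=\{t\in L: |\phi^{-1}(t)|>1\}$ and $Q_0(\phi)=\{t\in Q(\phi): t \text{ is an internal point of } L\}$. *)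

theory Defs
  imports "HOL-Analysis.Analysis"
begin

text \<open>
  A compact line is a type of class \<^class>\<open>linorder_topology\<close> whose universe is compact.
  On such a type every continuous real function is bounded, so \<open>'k \<Rightarrow>\<^sub>C real\<close> (bounded
  continuous functions with the supremum norm) is the Banach space \<open>C(K)\<close>.
\<close>

definition c0 :: "(nat \<Rightarrow>\<^sub>C real) set"
  where "c0 = {x. apply_bcontfun x \<longlonglongrightarrow> 0}"

text \<open>
  Both \<open>Y\<close> and the target \<open>Z\<close> are linear subspaces of ambient normed spaces; the values of
  \<open>T\<close> outside \<open>Y\<close> are irrelevant.
\<close>

definition bounded_operator_on ::
    "'a::real_normed_vector set \<Rightarrow> 'b::real_normed_vector set \<Rightarrow> ('a \<Rightarrow> 'b) \<Rightarrow> bool"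
  where "bounded_operator_on Y Z T \<longleftrightarrow>
    (\<forall>x\<in>Y. T x \<in> Z) \<and>
    (\<forall>x\<in>Y. \<forall>y\<in>Y. T (x + y) = T x + T y) \<and>
    (\<forall>c. \<forall>x\<in>Y. T (c *\<^sub>R x) = c *\<^sub>R T x) \<and>
    (\<exists>B. \<forall>x\<in>Y. norm (T x) \<le> B * norm x)"

text \<open>Meant for closed linear subspaces \<open>Y\<close> of the Banach space given by the type \<open>'a\<close>.\<close>

definition c0_extension_property_in :: "'a::real_normed_vector set \<Rightarrow> bool"
  where "c0_extension_property_in Y \<longleftrightarrow>
    (\<forall>T. bounded_operator_on Y c0 T \<longrightarrow>
      (\<exists>S. bounded_operator_on UNIV c0 S \<and> (\<forall>y\<in>Y. S y = T y)))"

text \<open>Only meaningful for continuous \<open>\<phi>\<close>, see \<open>apply_pullback\<close>.\<close>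

definition pullback ::
    "('k::topological_space \<Rightarrow> 'l::topological_space) \<Rightarrow> ('l \<Rightarrow>\<^sub>C real) \<Rightarrow> ('k \<Rightarrow>\<^sub>C real)"
  where "pullback \<phi> f = Bcontfun (apply_bcontfun f \<circ> \<phi>)"

lemma apply_pullback:
  assumes "continuous_on UNIV \<phi>"
  shows "apply_bcontfun (pullback \<phi> f) = apply_bcontfun f \<circ> \<phi>"
proof -
  have "continuous_on UNIV (apply_bcontfun f \<circ> \<phi>)"
    using assms by (intro continuous_on_compose) auto
  moreover have "bounded (range (apply_bcontfun f \<circ> \<phi>))"
    by (rule bounded_subset[OF bounded_apply_bcontfun[of f]]) auto
  ultimately show ?thesis
    unfolding pullback_def by (intro Bcontfun_inverse) (auto simp: bcontfun_def)
qed

definition has_c0_extension_property ::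
    "('k::topological_space \<Rightarrow> 'l::topological_space) \<Rightarrow> bool"
  where "has_c0_extension_property \<phi> \<longleftrightarrow> c0_extension_property_in (range (pullback \<phi>))"

definition internal_point :: "'a::linorder \<Rightarrow> bool"
  where "internal_point x \<longleftrightarrow>
    \<not> (\<forall>y. x \<le> y) \<and> \<not> (\<forall>y. y \<le> x) \<and>
    (\<forall>y. y > x \<longrightarrow> {x<..<y} \<noteq> {}) \<and>
    (\<forall>y. y < x \<longrightarrow> {y<..<x} \<noteq> {})"

text \<open>
  The fibre has more than one point; \<^const>\<open>card\<close> is avoided since it is \<open>0\<close> on infinite fibres.
\<close>

definition Q :: "('k \<Rightarrow> 'l) \<Rightarrow> 'l set"
  where "Q \<phi> = {t. \<exists>x\<in>\<phi> -` {t}. \<exists>y\<in>\<phi> -` {t}. x \<noteq> y}"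

definition Q0 :: "('k \<Rightarrow> 'l::linorder) \<Rightarrow> 'l set"
  where "Q0 \<phi> = {t \<in> Q \<phi>. internal_point t}"

end

theory Submission
  imports Defs "HOL-Probability.Discrete_Topology"
begin

text \<open>
  An operator from \<open>C(L)\<close> into \<open>c0\<close> is a bounded sequence of functionals \<open>T n\<close> tending to zero
  pointwise.  Each is extended, by the Hahn-Banach theorem, to a functional \<open>N n\<close> on all bounded
  functions on \<open>L\<close>; its distribution function \<open>G n t\<close>, the value at the indicator of \<open>{..<t}\<close>, plays the
  role of the distribution function of a measure.

  On end points of fibres, continuous functions on \<open>K\<close> are uniform limits of pulled back functions
  and their cut-offs at jumps, a jump being a point \<open>t\<close> of \<open>Q \<phi>\<close>.  Hence extending the operator amounts
  to finding weights \<open>d n t\<close>, with \<open>\<Sum>t. \<bar>d n t\<bar>\<close> bounded in \<open>n\<close>, such that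
  \<open>G n t - d n t\<close> tends to zero for every jump \<open>t\<close>: the weight multiplies the difference of the
  evaluations at the two ends of the fibre.

  For sufficiency, sums of \<open>\<bar>G n t\<bar>\<close> over a fixed finite set of points are eventually bounded
  (\<open>eventually_sum_prefix_le\<close>), so a diagonal argument provides weights as soon as \<open>G n t\<close>
  tends to zero at all but countably many jumps.  The exceptional jumps are, up to a
  countable set, contained in countably many \<open>G\<^sub>\<delta>\<close> sets of internal points
  (\<open>countable_non_null_points\<close>), to which the hypothesis applies.

  For necessity, a \<open>G\<^sub>\<delta>\<close> set \<open>C\<close> of internal points carries a sequence of intervals that contain
  every point of \<open>C\<close>, up to countably many, infinitely often, and whose end points are asymptotically
  indistinguishable for continuous functions (\<open>null_sequence_of_intervals\<close>).  Differences of the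
  evaluations at these end points form an operator with \<open>\<bar>G n t\<bar> = 1\<close> infinitely often for these \<open>t\<close>.
  The weights would be away from zero at all jumps among them, but for each \<open>n\<close> only finitely many weights
  can be (\<open>finite_small_gap_values\<close>).
\<close>

section \<open>Extension of functionals\<close>

text \<open>
  The functional and its partial extensions are represented by their graphs, which are subspaces
  of the product with the real line.  The bound by the norm forces such a subspace to be
  single-valued: it contains \<open>(0, r)\<close> and \<open>(0, - r)\<close> together, so \<open>r \<le> 0\<close> and \<open>- r \<le> 0\<close>.
  Hence linearity and domination are preserved by unions of chains, and a maximal graph given by
  Zorn's lemma must be defined everywhere.
\<close>

lemma hahn_banach_norm:
  fixes f :: "'a::real_normed_vector \<Rightarrow> real"
  assumes Y: "subspace Y" and M: "M \<ge> 0"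
    and add: "\<And>x y. x \<in> Y \<Longrightarrow> y \<in> Y \<Longrightarrow> f (x + y) = f x + f y"
    and scale: "\<And>c x. x \<in> Y \<Longrightarrow> f (c *\<^sub>R x) = c * f x"
    and bound: "\<And>x. x \<in> Y \<Longrightarrow> \<bar>f x\<bar> \<le> M * norm x"
  shows "\<exists>F. linear F \<and> (\<forall>x. \<bar>F x\<bar> \<le> M * norm x) \<and> (\<forall>x\<in>Y. F x = f x)"
proof -
  define \<G> :: "('a \<times> real) set set" where
    "\<G> = {G. subspace G \<and> (\<forall>x r. (x, r) \<in> G \<longrightarrow> r \<le> M * norm x) \<and> (\<lambda>x. (x, f x)) ` Y \<subseteq> G}"
  have "f 0 = 0"
    using scale[of 0 0] Y by (simp add: subspace_0)
  then have graph: "(\<lambda>x. (x, f x)) ` Y \<in> \<G>"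
    using Y add scale bound unfolding \<G>_def
    by (auto simp: subspace_def abs_le_iff image_iff zero_prod_def)
  have chain: "\<Union>\<C> \<in> \<G>" if "\<C> \<noteq> {}" and ch: "subset.chain \<G> \<C>" for \<C>
  proof -
    have sub: "\<C> \<subseteq> \<G>" and comp: "\<And>A B. A \<in> \<C> \<Longrightarrow> B \<in> \<C> \<Longrightarrow> A \<subseteq> B \<or> B \<subseteq> A"
      using ch by (auto simp: subset_chain_def)
    have "subspace (\<Union>\<C>)"
      unfolding subspace_def
    proof (intro conjI ballI allI)
      show "0 \<in> \<Union>\<C>"
        using \<open>\<C> \<noteq> {}\<close> sub unfolding \<G>_def by (blast intro: subspace_0)
    next
      fix x y assume "x \<in> \<Union>\<C>" "y \<in> \<Union>\<C>"
      then obtain A where "A \<in> \<C>" "x \<in> A" "y \<in> A"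
        using comp by blast
      then show "x + y \<in> \<Union>\<C>"
        using sub by (auto simp: \<G>_def intro: subspace_add)
    next
      fix c x assume "x \<in> \<Union>\<C>"
      then show "c *\<^sub>R x \<in> \<Union>\<C>"
        using sub by (auto simp: \<G>_def intro: subspace_scale)
    qed
    then show ?thesis
      using sub \<open>\<C> \<noteq> {}\<close> unfolding \<G>_def by blast
  qed
  obtain G where G: "G \<in> \<G>" and max: "\<And>X. X \<in> \<G> \<Longrightarrow> G \<subseteq> X \<Longrightarrow> X = G"
    using subset_Zorn_nonempty[of \<G>] graph chain by blast
  have sG: "subspace G" and bG: "\<And>x r. (x, r) \<in> G \<Longrightarrow> r \<le> M * norm x"
    and fG: "\<And>x. x \<in> Y \<Longrightarrow> (x, f x) \<in> G"
    using G by (auto simp: \<G>_def)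
  have uniq: "r = s" if "(x, r) \<in> G" "(x, s) \<in> G" for x r s
    using bG[of 0 "r - s"] bG[of 0 "s - r"] subspace_diff[OF sG that] subspace_diff[OF sG that(2,1)]
    by simp
  have total: "\<exists>r. (x0, r) \<in> G" for x0
  proof -
    \<comment> \<open>Domination by the norm forces the value \<open>c\<close> at the new vector \<open>x0\<close> to lie above \<open>L\<close> and below the right-hand sides of \<open>le\<close>.\<close>
    define L where "L = (\<lambda>(y, r). r - M * norm (y - x0)) ` G"
    have le: "r - M * norm (y - x0) \<le> M * norm (z + x0) - s" if "(y, r) \<in> G" "(z, s) \<in> G" for y r z s
    proof -
      have "r + s \<le> M * norm (y + z)"
        using bG subspace_add[OF sG that] by simp
      also have "\<dots> \<le> M * (norm (y - x0) + norm (z + x0))"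
        using norm_triangle_ineq[of "y - x0" "z + x0"] M by (intro mult_left_mono) auto
      finally show ?thesis
        by (simp add: algebra_simps)
    qed
    have zero: "(0, 0) \<in> G"
      using subspace_0[OF sG] by (simp add: zero_prod_def)
    have "bdd_above L"
      unfolding L_def using le[OF _ zero] by (intro bdd_aboveI[of _ "M * norm x0"]) auto
    define c where "c = Sup L"
    have low: "r - M * norm (y - x0) \<le> c" if "(y, r) \<in> G" for y r
      unfolding c_def using that \<open>bdd_above L\<close> by (intro cSup_upper) (auto simp: L_def)
    have up: "c \<le> M * norm (z + x0) - s" if "(z, s) \<in> G" for z s
      unfolding c_def using that zero le by (intro cSup_least) (auto simp: L_def)
    define G' where "G' = {(y + a *\<^sub>R x0, r + a * c) | y r a. (y, r) \<in> G}"
    have "subspace G'"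
      unfolding subspace_def
    proof (intro conjI ballI allI)
      show "0 \<in> G'"
        using zero unfolding G'_def zero_prod_def
        by (intro CollectI exI[of _ "0::'a"] exI[of _ "0::real"]) auto
    next
      fix u v assume "u \<in> G'" "v \<in> G'"
      then obtain y r a y' r' a' where "u = (y + a *\<^sub>R x0, r + a * c)" "(y, r) \<in> G"
          "v = (y' + a' *\<^sub>R x0, r' + a' * c)" "(y', r') \<in> G"
        by (auto simp: G'_def)
      then show "u + v \<in> G'"
        using subspace_add[OF sG, of "(y, r)" "(y', r')"] unfolding G'_def
        by (intro CollectI exI[of _ "y + y'"] exI[of _ "r + r'"] exI[of _ "a + a'"])
           (auto simp: algebra_simps)
    next
      fix k u assume "u \<in> G'"
      then obtain y r a where "u = (y + a *\<^sub>R x0, r + a * c)" "(y, r) \<in> G"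
        by (auto simp: G'_def)
      then show "k *\<^sub>R u \<in> G'"
        using subspace_scale[OF sG, of "(y, r)" k] unfolding G'_def
        by (intro CollectI exI[of _ "k *\<^sub>R y"] exI[of _ "k * r"] exI[of _ "k * a"])
           (auto simp: algebra_simps)
    qed
    moreover have "r + a * c \<le> M * norm (y + a *\<^sub>R x0)" if "(y, r) \<in> G" for y r a
    proof (cases a "0::real" rule: linorder_cases)
      case equal
      then show ?thesis
        using bG that by simp
    next
      case greater
      have "c \<le> M * norm (y /\<^sub>R a + x0) - r / a"
        using up[of "y /\<^sub>R a" "r / a"] subspace_scale[OF sG that, of "inverse a"]
        by (simp add: field_simps)
      then have "a * c \<le> a * (M * norm (y /\<^sub>R a + x0) - r / a)"
        using greater by simp
      also have "\<dots> = M * (\<bar>a\<bar> * norm (y /\<^sub>R a + x0)) - r"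
        using greater by (simp add: algebra_simps)
      also have "\<bar>a\<bar> * norm (y /\<^sub>R a + x0) = norm (y + a *\<^sub>R x0)"
        using greater by (simp only: norm_scaleR[symmetric]) (simp add: scaleR_add_right)
      finally show ?thesis
        by simp
    next
      case less
      define b where "b = - a"
      have b: "b > 0"
        using less by (simp add: b_def)
      have "r / b - M * norm (y /\<^sub>R b - x0) \<le> c"
        using low[of "y /\<^sub>R b" "r / b"] subspace_scale[OF sG that, of "inverse b"]
        by (simp add: field_simps)
      then have "b * (r / b - M * norm (y /\<^sub>R b - x0)) \<le> b * c"
        using b by simp
      then have "r - M * (\<bar>b\<bar> * norm (y /\<^sub>R b - x0)) \<le> b * c"
        using b by (simp add: algebra_simps)
      also have "\<bar>b\<bar> * norm (y /\<^sub>R b - x0) = norm (y - b *\<^sub>R x0)"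
        using b by (simp only: norm_scaleR[symmetric]) (simp add: scaleR_diff_right)
      finally show ?thesis
        by (simp add: b_def)
    qed
    moreover have "G \<subseteq> G'"
    proof
      fix u assume "u \<in> G"
      then show "u \<in> G'"
        unfolding G'_def by (intro CollectI exI[of _ "fst u"] exI[of _ "snd u"] exI[of _ 0]) auto
    qed
    moreover have "(\<lambda>x. (x, f x)) ` Y \<subseteq> G'"
      using fG \<open>G \<subseteq> G'\<close> by blast
    ultimately have "G' \<in> \<G>"
      by (auto simp: \<G>_def G'_def)
    then have "G' = G"
      using max \<open>G \<subseteq> G'\<close> by blast
    moreover have "(x0, c) \<in> G'"
      using zero unfolding G'_def
      by (intro CollectI exI[of _ "0::'a"] exI[of _ "0::real"] exI[of _ 1]) auto
    ultimately show ?thesis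
      by blast
  qed
  define F where "F x = (THE r. (x, r) \<in> G)" for x
  have F: "(x, F x) \<in> G" for x
    unfolding F_def using total[of x] uniq by (metis theI)
  have "linear F"
  proof (rule linearI)
    show "F (x + y) = F x + F y" for x y
      using uniq[OF F] subspace_add[OF sG F[of x] F[of y]] by simp
    show "F (k *\<^sub>R x) = k *\<^sub>R F x" for k x
      using uniq[OF F] subspace_scale[OF sG F[of x], of k] by simp
  qed
  moreover have "\<bar>F x\<bar> \<le> M * norm x" for x
    using bG[OF F, of x] bG[OF F, of "- x"] linear_neg[OF \<open>linear F\<close>, of x] by simp
  moreover have "F x = f x" if "x \<in> Y" for x
    using uniq[OF F fG[OF that]] .
  ultimately show ?thesis
    by blast
qed

text \<open>
  A finitely additive signed measure of total variation at most \<open>M\<close>, written as the integral that it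
  defines on bounded functions; on unbounded functions its values are arbitrary.  Finite additivity is enough to speak
  of distribution functions and atoms, and it comes from the Hahn-Banach theorem instead of the
  representation of functionals by regular measures.
\<close>

locale bounded_functional =
  fixes N :: "('a \<Rightarrow> real) \<Rightarrow> real" and M :: real
  assumes add: "bounded (range f) \<Longrightarrow> bounded (range g) \<Longrightarrow> N (\<lambda>x. f x + g x) = N f + N g"
    and scale: "bounded (range f) \<Longrightarrow> N (\<lambda>x. c * f x) = c * N f"
    and bound: "(\<And>x. \<bar>f x\<bar> \<le> B) \<Longrightarrow> \<bar>N f\<bar> \<le> M * B"
begin

lemma zero: "N (\<lambda>x. 0) = 0"
  using scale[of "\<lambda>x. 0" 0] by simp

lemma nonneg: "M \<ge> 0"
  using bound[of "\<lambda>x. 0" 1] by auto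

lemma diff:
  assumes "bounded (range f)" "bounded (range g)"
  shows "N (\<lambda>x. f x - g x) = N f - N g"
proof -
  have "bounded (range (\<lambda>x. - 1 * g x))"
    using assms(2) bounded_minus_comp[of g UNIV] by simp
  then show ?thesis
    using add[OF assms(1), of "\<lambda>x. - 1 * g x"] scale[OF assms(2), of "- 1"] by simp
qed

lemma sum:
  assumes "finite F" "\<And>i. i \<in> F \<Longrightarrow> bounded (range (u i))"
  shows "N (\<lambda>x. \<Sum>i\<in>F. u i x) = (\<Sum>i\<in>F. N (u i)) \<and> bounded (range (\<lambda>x. \<Sum>i\<in>F. u i x))"
  using assms
proof (induction F rule: finite_induct)
  case empty
  then show ?case
    by (simp add: zero image_constant_conv)
next
  case (insert i F)
  then show ?case
    using add[of "u i" "\<lambda>x. \<Sum>i\<in>F. u i x"] by (simp add: bounded_plus_comp)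
qed

text \<open>Choosing the signs of the summands turns the sum of the moduli into a single value of
  the functional, and disjointness of the supports keeps that argument bounded by one.\<close>

lemma sum_abs_disjoint_le:
  assumes "finite F" and u: "\<And>i x. i \<in> F \<Longrightarrow> \<bar>u i x\<bar> \<le> 1"
    and disj: "\<And>i j x. i \<in> F \<Longrightarrow> j \<in> F \<Longrightarrow> i \<noteq> j \<Longrightarrow> u i x = 0 \<or> u j x = 0"
  shows "(\<Sum>i\<in>F. \<bar>N (u i)\<bar>) \<le> M"
proof -
  let ?s = "\<lambda>i. sgn (N (u i))"
  have bdd: "bounded (range (u i))" if "i \<in> F" for i
    using u[OF that] by (auto simp: bounded_iff)
  have "bounded (range (\<lambda>x. ?s i * u i x))" if "i \<in> F" for i
    using bdd[OF that] bounded_scaleR_comp[of "u i" UNIV "?s i"] by simp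
  then have "(\<Sum>i\<in>F. N (\<lambda>x. ?s i * u i x)) = N (\<lambda>x. \<Sum>i\<in>F. ?s i * u i x)"
    using sum[OF \<open>finite F\<close>, of "\<lambda>i x. ?s i * u i x"] by simp
  moreover have "N (\<lambda>x. ?s i * u i x) = \<bar>N (u i)\<bar>" if "i \<in> F" for i
    using scale[OF bdd[OF that], of "?s i"] by (simp only: abs_sgn mult.commute)
  ultimately have "(\<Sum>i\<in>F. \<bar>N (u i)\<bar>) = N (\<lambda>x. \<Sum>i\<in>F. ?s i * u i x)"
    by simp
  also have "\<dots> \<le> M * 1"
  proof (rule order_trans[OF abs_ge_self bound])
    fix x
    show "\<bar>\<Sum>i\<in>F. ?s i * u i x\<bar> \<le> 1"
    proof (cases "\<exists>j\<in>F. u j x \<noteq> 0")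
      case True
      then obtain j where j: "j \<in> F" "u j x \<noteq> 0"
        by blast
      then have "(\<Sum>i\<in>F. ?s i * u i x) = (\<Sum>i\<in>{j}. ?s i * u i x)"
        using disj \<open>finite F\<close> by (intro sum.mono_neutral_right) auto
      then show ?thesis
        using u[OF j(1), of x] by (auto simp: sgn_if)
    next
      case False
      then have "(\<Sum>i\<in>F. ?s i * u i x) = 0"
        by (intro sum.neutral) auto
      then show ?thesis by simp
    qed
  qed
  finally show ?thesis by simp
qed

end

text \<open>Being bounded is all that is asked of the functions in the domain of the extension, so the
  Hahn-Banach theorem is applied to the bounded functions on the discrete copy of the space.\<close>

lemma bounded_functional_extension:
  fixes T :: "('a::topological_space \<Rightarrow>\<^sub>C real) \<Rightarrow> real"
  assumes "linear T" and M: "M \<ge> 0" and T: "\<And>f. \<bar>T f\<bar> \<le> M * norm f"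
  shows "\<exists>N. bounded_functional N M \<and> (\<forall>f. N (apply_bcontfun f) = T f)"
proof -
  define \<iota> :: "('a \<Rightarrow> real) \<Rightarrow> ('a discrete \<Rightarrow>\<^sub>C real)"
    where "\<iota> f = Bcontfun (f \<circ> of_discrete)" for f
  have cont: "continuous_on UNIV (g :: 'a discrete \<Rightarrow> real)" for g
    by (simp add: continuous_on_open_invariant open_discrete)
  have \<iota>: "apply_bcontfun (\<iota> f) x = f (of_discrete x)" if "bounded (range f)" for f x
  proof -
    have "bounded (range (f \<circ> of_discrete))"
      by (rule bounded_subset[OF that]) auto
    then have "f \<circ> of_discrete \<in> bcontfun"
      using cont by (auto simp: bcontfun_def)
    then show ?thesis
      unfolding \<iota>_def by (simp add: Bcontfun_inverse)
  qed
  define j where "j f = \<iota> (apply_bcontfun f)" for f :: "'a \<Rightarrow>\<^sub>C real"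
  have j: "apply_bcontfun (j f) x = apply_bcontfun f (of_discrete x)" for f x
    unfolding j_def by (rule \<iota>) simp
  have j_add: "j (f + g) = j f + j g" for f g
    by (rule bcontfun_eqI) (simp add: j)
  have j_scale: "j (c *\<^sub>R f) = c *\<^sub>R j f" for c f
    by (rule bcontfun_eqI) (simp add: j)
  have j_inj: "f = g" if "j f = j g" for f g
  proof (rule bcontfun_eqI)
    show "apply_bcontfun f x = apply_bcontfun g x" for x
      using j[of f "discrete x"] j[of g "discrete x"] that by (simp add: discrete_inverse)
  qed
  have inv_j: "inv j (j f) = f" for f
    using j_inj by (simp add: inj_def)
  have norm_j: "norm f \<le> norm (j f)" for f
  proof (rule norm_bound)
    show "norm (apply_bcontfun f x) \<le> norm (j f)" for x
      using norm_bounded[of "j f" "discrete x"] by (simp add: j discrete_inverse)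
  qed
  have "linear j"
    using j_add j_scale by (simp add: linear_iff)
  then have "subspace (range j)"
    by (simp add: linear_subspace_image)
  have bT: "\<bar>T (inv j h)\<bar> \<le> M * norm h" if h: "h \<in> range j" for h
  proof -
    obtain f where f: "h = j f"
      using h by blast
    have "\<bar>T f\<bar> \<le> M * norm f"
      by (rule T)
    also have "\<dots> \<le> M * norm (j f)"
      using norm_j M by (rule mult_left_mono)
    finally show ?thesis
      by (simp add: f inv_j)
  qed
  have "\<exists>F. linear F \<and> (\<forall>x. \<bar>F x\<bar> \<le> M * norm x) \<and> (\<forall>x\<in>range j. F x = T (inv j x))"
  proof (rule hahn_banach_norm[OF \<open>subspace (range j)\<close> M])
    show "T (inv j (x + y)) = T (inv j x) + T (inv j y)" if "x \<in> range j" "y \<in> range j" for x y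
      using that \<open>linear T\<close> by (auto simp: inv_j linear_add simp flip: j_add)
    show "T (inv j (c *\<^sub>R x)) = c * T (inv j x)" if "x \<in> range j" for c x
      using that \<open>linear T\<close> by (auto simp: inv_j linear_scale simp flip: j_scale)
  qed (rule bT)
  then obtain F where F: "linear F" "\<And>x. \<bar>F x\<bar> \<le> M * norm x" "\<And>f. F (j f) = T f"
    by (auto simp: inv_j)
  have "bounded_functional (\<lambda>f. F (\<iota> f)) M"
  proof
    fix f g :: "'a \<Rightarrow> real" assume f: "bounded (range f)" and g: "bounded (range g)"
    have "\<iota> (\<lambda>x. f x + g x) = \<iota> f + \<iota> g"
      using f g by (intro bcontfun_eqI) (simp add: \<iota> bounded_plus_comp)
    then show "F (\<iota> (\<lambda>x. f x + g x)) = F (\<iota> f) + F (\<iota> g)"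
      using F(1) by (simp add: linear_add)
  next
    fix f :: "'a \<Rightarrow> real" and c assume f: "bounded (range f)"
    then have "bounded (range (\<lambda>x. c * f x))"
      using bounded_scaleR_comp[of f UNIV c] by simp
    then have "\<iota> (\<lambda>x. c * f x) = c *\<^sub>R \<iota> f"
      using f by (intro bcontfun_eqI) (simp add: \<iota>)
    then show "F (\<iota> (\<lambda>x. c * f x)) = c * F (\<iota> f)"
      using F(1) by (simp add: linear_scale)
  next
    fix f :: "'a \<Rightarrow> real" and B assume B: "\<And>x. \<bar>f x\<bar> \<le> B"
    then have "bounded (range f)"
      by (auto simp: bounded_iff)
    then have "norm (\<iota> f) \<le> B"
      using B by (intro norm_bound) (simp add: \<iota>)
    then show "\<bar>F (\<iota> f)\<bar> \<le> M * B"
      using F(2)[of "\<iota> f"] M by (meson mult_left_mono order_trans)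
  qed
  then show ?thesis
    using F(3) by (auto simp: j_def)
qed

section \<open>Continuous functions on compact lines\<close>

text \<open>
  A point that is not internal is an extreme point or has an immediate neighbour, and in each of these
  cases one of the two closed rays at the point is open.
\<close>

lemma not_internal_pointD:
  fixes t :: "'a::linorder_topology"
  assumes "\<not> internal_point t"
  shows "open {t..} \<or> open {..t}"
proof -
  consider "\<forall>y. t \<le> y" | "\<forall>y. y \<le> t" | y where "t < y" "{t<..<y} = {}" | y where "y < t" "{y<..<t} = {}"
    using assms unfolding internal_point_def by blast
  then show ?thesis
  proof cases
    case 1
    then have "{t..} = UNIV" by auto
    then show ?thesis by simp
  next
    case 2
    then have "{..t} = UNIV" by auto
    then show ?thesis by simp
  next
    case 3
    have "x \<le> t \<longleftrightarrow> x < y" for x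
      by (cases "x \<le> t") (use 3 in \<open>auto simp: set_eq_iff\<close>)
    then have "{..t} = {..<y}" by auto
    then show ?thesis by simp
  next
    case 4
    have "t \<le> x \<longleftrightarrow> y < x" for x
      by (cases "t \<le> x") (use 4 in \<open>auto simp: set_eq_iff\<close>)
    then have "{t..} = {y<..}" by auto
    then show ?thesis by simp
  qed
qed

lemma continuous_on_indicator_clopen:
  fixes A :: "'a::topological_space set"
  assumes "open A" "closed A"
  shows "continuous_on UNIV (indicator A :: 'a \<Rightarrow> real)"
proof -
  have "continuous_on A (indicator A :: 'a \<Rightarrow> real)"
    by (rule continuous_on_eq[of A "\<lambda>_. 1"]) auto
  moreover have "continuous_on (- A) (indicator A :: 'a \<Rightarrow> real)"
    by (rule continuous_on_eq[of "- A" "\<lambda>_. 0"]) auto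
  ultimately have "continuous_on (A \<union> - A) (indicator A :: 'a \<Rightarrow> real)"
    using assms by (intro continuous_on_open_Un) auto
  then show ?thesis by simp
qed

lemma Urysohn_compact:
  fixes A B :: "'a::t2_space set"
  assumes "compact (UNIV :: 'a set)" "closed A" "closed B" "A \<inter> B = {}"
  shows "\<exists>g :: 'a \<Rightarrow> real. continuous_on UNIV g \<and> (\<forall>x. 0 \<le> g x \<and> g x \<le> 1) \<and>
    (\<forall>x\<in>A. g x = 1) \<and> (\<forall>x\<in>B. g x = 0)"
proof -
  have "Hausdorff_space (euclidean :: 'a topology)"
    unfolding Hausdorff_space_def
  proof (intro allI impI)
    fix x y :: 'a assume "x \<in> topspace euclidean \<and> y \<in> topspace euclidean \<and> x \<noteq> y"
    then obtain U V where "open U" "open V" "x \<in> U" "y \<in> V" "U \<inter> V = {}"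
      using hausdorff[of x y] by auto
    then show "\<exists>U V. openin euclidean U \<and> openin euclidean V \<and> x \<in> U \<and> y \<in> V \<and> disjnt U V"
      by (auto simp: disjnt_def simp flip: open_openin)
  qed
  then have "normal_space (euclidean :: 'a topology)"
    using assms(1) by (intro compact_Hausdorff_or_regular_imp_normal_space) (auto simp: compact_space_def)
  then obtain f :: "'a \<Rightarrow> real" where
    f: "continuous_map euclidean (top_of_set {0..1}) f" "f ` B \<subseteq> {0}" "f ` A \<subseteq> {1}"
    using Urysohn_lemma[of euclidean B A 0 1] assms by (auto simp: disjnt_def)
  then have "continuous_on UNIV f" "\<forall>x. 0 \<le> f x \<and> f x \<le> 1"
    by (auto simp: continuous_map_in_subtopology image_subset_iff Pi_iff)
  then show ?thesis
    using f by (intro exI[of _ f]) auto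
qed

text \<open>
  A continuous substitute for the indicator of the ray below \<open>t\<close>, dropping to zero before the next
  element of \<open>F\<close>.  Two such functions, with \<open>t\<close> ranging over \<open>F\<close>, differ from the true
  indicators on disjoint sets, which is what makes sums over \<open>F\<close> controllable.
\<close>

lemma step_function:
  fixes t :: "'a::linorder_topology"
  assumes "compact (UNIV :: 'a set)" "finite F"
  shows "\<exists>g :: 'a \<Rightarrow> real. continuous_on UNIV g \<and> (\<forall>x. 0 \<le> g x \<and> g x \<le> 1) \<and>
    (\<forall>x\<le>t. g x = 1) \<and> (\<forall>s\<in>F. t < s \<longrightarrow> (\<forall>x\<ge>s. g x = 0))"
proof -
  have "closed (\<Union>s\<in>{s \<in> F. t < s}. {s..})"
    using assms(2) by (intro closed_UN) auto
  moreover have "{..t} \<inter> (\<Union>s\<in>{s \<in> F. t < s}. {s..}) = {}"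
    by auto
  ultimately obtain g :: "'a \<Rightarrow> real" where "continuous_on UNIV g" "\<forall>x. 0 \<le> g x \<and> g x \<le> 1"
    "\<forall>x\<in>{..t}. g x = 1" "\<forall>x\<in>\<Union>s\<in>{s \<in> F. t < s}. {s..}. g x = 0"
    using Urysohn_compact[OF assms(1) closed_atMost[of t]] by meson
  then show ?thesis
    by (intro exI[of _ g]) auto
qed

text \<open>
  Disjoint neighbourhoods alone would not do: the point is that any half-open intervals with end
  points in neighbourhoods of different points are disjoint.  Between \<open>s < t\<close> one cuts at a point
  strictly in between, or at \<open>t\<close> itself when there is none, since then the ray from \<open>t\<close> upwards is
  open.
\<close>

lemma finite_convex_separation:
  fixes H :: "'a::linorder_topology set"
  assumes "finite H"
  shows "\<exists>V. \<forall>t\<in>H. open (V t) \<and> t \<in> V t \<and> 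
    (\<forall>s\<in>H. s < t \<longrightarrow> (\<exists>u. (\<forall>x\<in>V s. x < u) \<and> (\<forall>x\<in>V t. u \<le> x)))"
proof -
  have "\<exists>u W. s < u \<and> open W \<and> t \<in> W \<and> W \<subseteq> {u..}" if "s < t" for s t :: 'a
  proof (cases "{s<..<t} = {}")
    case True
    then have "\<not> (s < x \<and> x < t)" for x
      by auto
    then show ?thesis
      using that by (intro exI[of _ t] exI[of _ "{s<..}"]) (auto intro: leI)
  next
    case False
    then obtain u where "s < u" "u < t" by auto
    then show ?thesis
      by (intro exI[of _ u] exI[of _ "{u<..}"]) auto
  qed
  then obtain u W where uW: "\<And>s t :: 'a. s < t \<Longrightarrow> s < u s t \<and> open (W s t) \<and> t \<in> W s t \<and> W s t \<subseteq> {u s t..}"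
    by metis
  define V where "V t = (\<Inter>s\<in>{s \<in> H. t < s}. {..<u t s}) \<inter> (\<Inter>s\<in>{s \<in> H. s < t}. W s t)" for t
  have "open (V t)" "t \<in> V t" for t
    unfolding V_def using assms uW by (auto intro!: open_Int open_INT)
  moreover have "(\<forall>x\<in>V s. x < u s t) \<and> (\<forall>x\<in>V t. u s t \<le> x)" if "s \<in> H" "t \<in> H" "s < t" for s t
    using that uW[OF that(3)] unfolding V_def by fastforce
  ultimately show ?thesis
    by blast
qed

section \<open>Distribution functions\<close>

context bounded_functional
begin

lemma bounded_indicator: "bounded (range (indicator A :: 'b \<Rightarrow> real))"
  by (auto simp: bounded_iff indicator_def)

lemma finite_large_atoms:
  assumes "\<epsilon> > 0"
  shows "finite {t. \<epsilon> < \<bar>N (indicator {t})\<bar>}"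
proof -
  have "card F \<le> nat \<lfloor>M / \<epsilon>\<rfloor>" if F: "F \<subseteq> {t. \<epsilon> < \<bar>N (indicator {t})\<bar>}" "finite F" for F
  proof -
    have "card F * \<epsilon> \<le> (\<Sum>t\<in>F. \<bar>N (indicator {t})\<bar>)"
      using F(1) by (intro sum_bounded_below) auto
    also have "\<dots> \<le> M"
      by (rule sum_abs_disjoint_le) (use F(2) in \<open>auto simp: indicator_def\<close>)
    finally show ?thesis
      using assms by (simp add: le_nat_floor field_simps)
  qed
  then show ?thesis
    by (intro conjunct1[OF finite_if_finite_subsets_card_bdd])
qed

lemma countable_atoms: "countable {t. N (indicator {t}) \<noteq> 0}"
proof -
  have "{t. N (indicator {t}) \<noteq> 0} = (\<Union>k. {t. 1 / real (Suc k) < \<bar>N (indicator {t})\<bar>})"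
  proof (intro set_eqI iffI)
    fix t assume "t \<in> {t. N (indicator {t}) \<noteq> 0}"
    then obtain k where "1 / real (Suc k) < \<bar>N (indicator {t})\<bar>"
      using nat_approx_posE[of "\<bar>N (indicator {t})\<bar>"] by auto
    then show "t \<in> (\<Union>k. {t. 1 / real (Suc k) < \<bar>N (indicator {t})\<bar>})"
      by blast
  qed (auto simp: not_less divide_simps)
  then show ?thesis
    using finite_large_atoms by (simp add: countable_finite)
qed

end

text \<open>
  The distribution function of \<open>N\<close> has variation at most \<open>M\<close>: its increments over disjoint intervals
  are the values of \<open>N\<close> on indicators of these intervals.  If it oscillated by more than
  \<open>1 / (k + 1)\<close> at many points, disjoint intervals near these points would add up to more than
  \<open>M\<close>.
\<close>

lemma countable_discontinuities:
  fixes N :: "('a::linorder_topology \<Rightarrow> real) \<Rightarrow> real"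
  assumes "bounded_functional N M"
  shows "countable {t. \<not> isCont (\<lambda>t. N (indicator {..<t})) t}"
proof -
  interpret bounded_functional N M by fact
  define G where "G t = N (indicator {..<t})" for t
  have G_diff: "G y - G x = N (indicator {x..<y})" if "x < y" for x y
  proof -
    have "indicator {x..<y} = (\<lambda>z. indicator {..<y} z - indicator {..<x} z :: real)"
      using that by (auto simp: indicator_def fun_eq_iff)
    then show ?thesis
      using diff[OF bounded_indicator bounded_indicator] by (simp add: G_def)
  qed
  define E where "E k = {t. \<forall>U. open U \<and> t \<in> U \<longrightarrow> (\<exists>x\<in>U. \<exists>y\<in>U. 1 / real (Suc k) < \<bar>G x - G y\<bar>)}" for k
  have "finite (E k)" for k
  proof -
    have "card H \<le> nat \<lfloor>M * Suc k\<rfloor>" if H: "H \<subseteq> E k" "finite H" for H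
    proof -
      obtain V where V: "\<And>t. t \<in> H \<Longrightarrow> open (V t) \<and> t \<in> V t"
        and sep: "\<And>s t. \<lbrakk>s \<in> H; t \<in> H; s < t\<rbrakk> \<Longrightarrow> \<exists>u. (\<forall>x\<in>V s. x < u) \<and> (\<forall>x\<in>V t. u \<le> x)"
        using finite_convex_separation[OF H(2)] by metis
      have "\<exists>x\<in>V t. \<exists>y\<in>V t. x < y \<and> 1 / real (Suc k) < \<bar>G y - G x\<bar>" if t: "t \<in> H" for t
      proof -
        obtain x y where xy: "x \<in> V t" "y \<in> V t" "1 / real (Suc k) < \<bar>G x - G y\<bar>"
          using V[OF t] H(1) t unfolding E_def by blast
        then have "x \<noteq> y" 
          by (auto simp: zero_less_divide_iff)
        then show ?thesis
          using xy by (metis abs_minus_commute neqE)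
      qed
      then obtain x y where xy: "\<And>t. t \<in> H \<Longrightarrow> x t \<in> V t \<and> y t \<in> V t \<and> x t < y t \<and>
          1 / real (Suc k) < \<bar>G (y t) - G (x t)\<bar>"
        by metis
      have disj: "{x s..<y s} \<inter> {x t..<y t} = {}" if st: "s \<in> H" "t \<in> H" "s < t" for s t
      proof -
        obtain u where "\<forall>x\<in>V s. x < u" "\<forall>x\<in>V t. u \<le> x"
          using sep[OF st] by (elim exE conjE)
        then have "y s < u" "u \<le> x t"
          using xy st by blast+
        then show ?thesis by auto
      qed
      then have "z \<notin> {x s..<y s} \<or> z \<notin> {x t..<y t}" if "s \<in> H" "t \<in> H" "s \<noteq> t" for s t z
        using that by (metis IntI empty_iff neqE)
      then have "(\<Sum>t\<in>H. \<bar>N (indicator {x t..<y t})\<bar>) \<le> M"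
        by (intro sum_abs_disjoint_le \<open>finite H\<close>) (simp_all add: indicator_def del: atLeastLessThan_iff)
      moreover have "card H * (1 / real (Suc k)) \<le> (\<Sum>t\<in>H. \<bar>N (indicator {x t..<y t})\<bar>)"
      proof (rule sum_bounded_below)
        show "1 / real (Suc k) \<le> \<bar>N (indicator {x t..<y t})\<bar>" if "t \<in> H" for t
          using xy[OF that] G_diff[of "x t" "y t"] by (metis less_imp_le)
      qed
      ultimately have "real (card H) / real (Suc k) \<le> M"
        by simp
      then have "real (card H) \<le> M * real (Suc k)"
        by (subst (asm) pos_divide_le_eq) auto
      then show ?thesis
        by (rule le_nat_floor)
    qed
    then show ?thesis
      by (intro conjunct1[OF finite_if_finite_subsets_card_bdd])
  qed
  moreover have "{t. \<not> isCont G t} \<subseteq> (\<Union>k. E k)"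
  proof (rule subsetI, rule ccontr)
    fix t assume "t \<in> {t. \<not> isCont G t}" and t: "t \<notin> (\<Union>k. E k)"
    have "(G \<longlongrightarrow> G t) (at t)"
    proof (rule tendstoI)
      fix e :: real assume "e > 0"
      then obtain k where k: "1 / real (Suc k) < e"
        by (rule nat_approx_posE)
      have "t \<notin> E k"
        using t by blast
      then obtain U where U: "open U" "t \<in> U"
        "\<forall>x\<in>U. \<forall>y\<in>U. \<not> 1 / real (Suc k) < \<bar>G x - G y\<bar>"
        unfolding E_def by blast
      have "\<forall>x\<in>U. dist (G x) (G t) < e"
      proof
        fix x assume "x \<in> U"
        then have "\<bar>G x - G t\<bar> \<le> 1 / real (Suc k)"
          using U(2,3) by (meson not_less)
        then show "dist (G x) (G t) < e"
          using k by (simp only: dist_real_def)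
      qed
      then show "\<forall>\<^sub>F x in at t. dist (G x) (G t) < e"
        using U(1,2) by (auto simp: eventually_at_topological)
    qed
    with \<open>t \<in> {t. \<not> isCont G t}\<close> show False
      by (simp add: isCont_def)
  qed
  moreover have "countable (\<Union>k. E k)"
    using \<open>\<And>k. finite (E k)\<close> by (simp add: countable_finite)
  ultimately have "countable {t. \<not> isCont G t}"
    using countable_subset by blast
  then show ?thesis
    by (simp add: G_def[abs_def])
qed

text \<open>
  A diagonal argument: enumerate \<open>B\<close>, and at time \<open>n\<close> take the longest initial segment, of length
  at most \<open>n\<close>, whose sum is at most \<open>C\<close>.  Every fixed segment is eventually admissible, so the chosen
  lengths tend to infinity.
\<close>

lemma exhausting_finite_subsets:
  fixes G :: "nat \<Rightarrow> 'a \<Rightarrow> real"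
  assumes "countable B" and "C \<ge> 0"
    and fin: "\<And>F. finite F \<Longrightarrow> F \<subseteq> B \<Longrightarrow> \<forall>\<^sub>F n in sequentially. (\<Sum>t\<in>F. \<bar>G n t\<bar>) \<le> C"
  shows "\<exists>H. (\<forall>n. finite (H n) \<and> H n \<subseteq> B \<and> (\<Sum>t\<in>H n. \<bar>G n t\<bar>) \<le> C) \<and>
    (\<forall>t\<in>B. \<forall>\<^sub>F n in sequentially. t \<in> H n)"
proof (cases "B = {}")
  case True
  then show ?thesis
    using \<open>C \<ge> 0\<close> by (intro exI[of _ "\<lambda>_. {}"]) auto
next
  case False
  define Bk where "Bk k = from_nat_into B ` {..<k}" for k
  define P where "P n k \<longleftrightarrow> k \<le> n \<and> (\<Sum>t\<in>Bk k. \<bar>G n t\<bar>) \<le> C" for n k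
  define k where "k n = Max {k. P n k}" for n
  have fin_P: "finite {k. P n k}" for n
    by (rule finite_subset[of _ "{..n}"]) (auto simp: P_def)
  have "P n 0" for n
    using \<open>C \<ge> 0\<close> by (simp add: P_def Bk_def)
  then have P: "P n (k n)" for n
    using Max_in[OF fin_P, of n] unfolding k_def by blast
  have sub: "Bk k \<subseteq> B" for k
    using False by (auto simp: Bk_def intro: from_nat_into)
  have "\<forall>\<^sub>F n in sequentially. t \<in> Bk (k n)" if t: "t \<in> B" for t
  proof -
    obtain i where i: "t = from_nat_into B i"
      using from_nat_into_surj[OF \<open>countable B\<close> t] by metis
    have "\<forall>\<^sub>F n in sequentially. (\<Sum>t\<in>Bk (Suc i). \<bar>G n t\<bar>) \<le> C"
      by (rule fin) (use sub in \<open>auto simp: Bk_def\<close>)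
    then show ?thesis
      using eventually_ge_at_top[of "Suc i"]
    proof eventually_elim
      case (elim n)
      then have "Suc i \<le> k n"
        unfolding k_def by (intro Max_ge fin_P) (simp add: P_def)
      then show ?case
        by (auto simp: i Bk_def)
    qed
  qed
  then show ?thesis
    using P sub by (intro exI[of _ "\<lambda>n. Bk (k n)"]) (auto simp: P_def Bk_def)
qed

section \<open>Sequences of functionals tending to zero\<close>

lemma bounded_operator_on_c0I:
  fixes S :: "nat \<Rightarrow> 'a::real_normed_vector \<Rightarrow> real"
  assumes lin: "\<And>n. linear (S n)" and bound: "\<And>n x. \<bar>S n x\<bar> \<le> B * norm x"
    and null: "\<And>x. x \<in> Y \<Longrightarrow> (\<lambda>n. S n x) \<longlonglongrightarrow> 0"
  shows "bounded_operator_on Y c0 (\<lambda>x. Bcontfun (\<lambda>n. S n x))"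
    and "apply_bcontfun (Bcontfun (\<lambda>n. S n x)) = (\<lambda>n. S n x)"
proof -
  have app: "apply_bcontfun (Bcontfun (\<lambda>n. S n x)) = (\<lambda>n. S n x)" for x
  proof (rule Bcontfun_inverse)
    have "bounded (range (\<lambda>n. S n x))"
      using bound by (auto simp: bounded_iff)
    then show "(\<lambda>n. S n x) \<in> bcontfun"
      by (simp add: bcontfun_def)
  qed
  then show "apply_bcontfun (Bcontfun (\<lambda>n. S n x)) = (\<lambda>n. S n x)" .
  define E where "E x = Bcontfun (\<lambda>n. S n x)" for x
  have E: "apply_bcontfun (E x) = (\<lambda>n. S n x)" for x
    by (simp add: E_def app)
  have "norm (E x) \<le> B * norm x" for x
    using bound by (intro norm_bound) (simp add: E)
  moreover have "E (x + y) = E x + E y" for x y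
    by (rule bcontfun_eqI) (simp add: E linear_add[OF lin])
  moreover have "E (c *\<^sub>R x) = c *\<^sub>R E x" for c x
    by (rule bcontfun_eqI) (simp add: E linear_scale[OF lin])
  ultimately have "bounded_operator_on Y c0 E"
    using null unfolding bounded_operator_on_def by (auto simp: c0_def E)
  then show "bounded_operator_on Y c0 (\<lambda>x. Bcontfun (\<lambda>n. S n x))"
    by (simp add: E_def[abs_def])
qed

text \<open>
  The coordinates of an operator into \<open>c0\<close> are uniformly bounded functionals that tend to zero
  pointwise; each of them is extended to all bounded functions.  Convergence to zero is inherited on
  continuous functions only.
\<close>

lemma c0_operator_functionals:
  fixes S :: "('a::topological_space \<Rightarrow>\<^sub>C real) \<Rightarrow> (nat \<Rightarrow>\<^sub>C real)"
  assumes "bounded_operator_on UNIV c0 S"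
  obtains M N where "\<And>n. bounded_functional (N n) M"
    "\<And>n f. N n (apply_bcontfun f) = apply_bcontfun (S f) n"
    "\<And>g. continuous_on UNIV g \<Longrightarrow> bounded (range g) \<Longrightarrow> (\<lambda>n. N n g) \<longlonglongrightarrow> 0"
proof -
  have S_c0: "\<And>x. S x \<in> c0" and S_add: "\<And>x y. S (x + y) = S x + S y"
    and S_scale: "\<And>c x. S (c *\<^sub>R x) = c *\<^sub>R S x"
    using assms by (auto simp: bounded_operator_on_def)
  obtain B where B: "\<And>x. norm (S x) \<le> B * norm x"
    using assms by (auto simp: bounded_operator_on_def)
  define M where "M = max B 0"
  have M: "norm (S x) \<le> M * norm x" for x
    unfolding M_def by (rule order_trans[OF B mult_right_mono]) auto
  have "\<exists>N. bounded_functional N M \<and> (\<forall>f. N (apply_bcontfun f) = apply_bcontfun (S f) n)" for n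
  proof (rule bounded_functional_extension)
    show "linear (\<lambda>f. apply_bcontfun (S f) n)"
      by (rule linearI) (simp_all add: S_add S_scale)
    show "\<bar>apply_bcontfun (S f) n\<bar> \<le> M * norm f" for f
      using norm_bounded[of "S f" n] M[of f] by simp
  qed (simp add: M_def)
  then obtain N where N: "\<And>n. bounded_functional (N n) M"
    "\<And>n f. N n (apply_bcontfun f) = apply_bcontfun (S f) n"
    by metis
  moreover have "(\<lambda>n. N n g) \<longlonglongrightarrow> 0" if g: "continuous_on UNIV g" "bounded (range g)" for g
  proof -
    have "apply_bcontfun (Bcontfun g) = g"
      using g by (intro Bcontfun_inverse) (simp add: bcontfun_def)
    then have "N n g = apply_bcontfun (S (Bcontfun g)) n" for n
      using N(2) by metis
    then show ?thesis
      using S_c0[of "Bcontfun g"] by (simp add: c0_def)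
  qed
  ultimately show thesis
    by (rule that)
qed

lemma bounded_operator_on_pullback:
  assumes "continuous_on UNIV \<phi>" "bounded_operator_on (range (pullback \<phi>)) Z T"
  shows "bounded_operator_on UNIV Z (\<lambda>f. T (pullback \<phi> f))"
proof -
  have add: "pullback \<phi> (f + g) = pullback \<phi> f + pullback \<phi> g" for f g
    by (rule bcontfun_eqI) (simp add: apply_pullback[OF assms(1)])
  have scale: "pullback \<phi> (c *\<^sub>R f) = c *\<^sub>R pullback \<phi> f" for c f
    by (rule bcontfun_eqI) (simp add: apply_pullback[OF assms(1)])
  have norm: "norm (pullback \<phi> f) \<le> norm f" for f
    using norm_bounded[of f] by (intro norm_bound) (simp add: apply_pullback[OF assms(1)])
  obtain B where B: "\<And>f. norm (T (pullback \<phi> f)) \<le> B * norm (pullback \<phi> f)"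
    using assms(2) by (auto simp: bounded_operator_on_def)
  have "norm (T (pullback \<phi> f)) \<le> max B 0 * norm f" for f
    by (rule order_trans[OF B mult_mono]) (use norm in auto)
  then show ?thesis
    using assms(2) by (auto simp: bounded_operator_on_def add scale)
qed

text \<open>
  Write \<open>G n t\<close> for the value of \<open>N n\<close> at the indicator of \<open>{..<t}\<close>.  Outside the countable set of
  discontinuities of the functions \<open>G n\<close>, the set where \<open>\<bar>G n t\<bar> > 1 / (j + 1)\<close> for infinitely many \<open>n\<close> agrees with the
  \<open>G\<^sub>\<delta>\<close> set obtained from the interiors.  This set can be pruned to consist of internal points by
  discarding the countably many atoms: at a point \<open>t\<close> that is not internal one of the rays
  \<open>{..<t}\<close> and \<open>{..t}\<close> is clopen, the functionals tend to zero on its indicator, and away from the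
  atoms both rays have the same value.  The hypothesis on \<open>G\<^sub>\<delta>\<close> sets then applies.
\<close>

lemma countable_non_null_points:
  fixes N :: "nat \<Rightarrow> ('l::linorder_topology \<Rightarrow> real) \<Rightarrow> real"
  assumes bf: "\<And>n. bounded_functional (N n) M"
    and null: "\<And>g. continuous_on UNIV g \<Longrightarrow> bounded (range g) \<Longrightarrow> (\<lambda>n. N n g) \<longlonglongrightarrow> 0"
    and cond: "\<And>C. gdelta_in euclidean C \<Longrightarrow> \<forall>x\<in>C. internal_point x \<Longrightarrow> countable (C \<inter> P)"
  shows "countable {t \<in> P. \<not> (\<lambda>n. N n (indicator {..<t})) \<longlonglongrightarrow> 0}"
proof -
  define G where "G n t = N n (indicator {..<t})" for n t
  define A where "A = (\<Union>n. {t. N n (indicator {t}) \<noteq> 0})"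
  define D where "D = (\<Union>n. {t. \<not> isCont (G n) t})"
  define U where "U n j = interior {t. 1 / real (Suc j) < \<bar>G n t\<bar>}" for n j
  define W where "W j = (\<Inter>m. \<Union>n\<in>{m..}. U n j)" for j
  have "countable A"
    unfolding A_def by (intro countable_UN bounded_functional.countable_atoms[OF bf]) auto
  have "countable D"
    unfolding D_def G_def by (intro countable_UN countable_discontinuities[OF bf]) auto
  have clopen: "(\<lambda>n. N n (indicator E)) \<longlonglongrightarrow> 0" if "open E" "closed E" for E
    using continuous_on_indicator_clopen[OF that] bounded_functional.bounded_indicator[OF bf]
    by (intro null)
  have internal: "internal_point t" if t: "t \<in> W j - A" for t j
  proof (rule ccontr)
    assume "\<not> internal_point t"
    then consider "open {t..}" | "open {..t}"
      using not_internal_pointD by blast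
    then have "(\<lambda>n. G n t) \<longlonglongrightarrow> 0"
    proof cases
      case 1
      moreover have "- {..<t} = {t..}"
        by auto
      ultimately have "closed {..<t}"
        by (simp add: closed_def)
      then show ?thesis
        unfolding G_def by (intro clopen) auto
    next
      case 2
      have "G n t = N n (indicator {..t})" for n
      proof -
        interpret bounded_functional "N n" M by (rule bf)
        have "indicator {..t} = (\<lambda>x. indicator {..<t} x + indicator {t} x :: real)"
          by (auto simp: indicator_def fun_eq_iff)
        then have "N n (indicator {..t}) = G n t + N n (indicator {t})"
          using add[OF bounded_indicator bounded_indicator] by (simp add: G_def)
        then show ?thesis
          using t by (auto simp: A_def)
      qed
      then show ?thesis
        using clopen[OF 2] by simp
    qed
    then have "\<forall>\<^sub>F n in sequentially. \<bar>G n t\<bar> < 1 / real (Suc j)"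
      using tendstoD[of "\<lambda>n. G n t" 0 sequentially "1 / real (Suc j)"] by (simp add: dist_real_def)
    then obtain m where m: "\<And>n. n \<ge> m \<Longrightarrow> \<bar>G n t\<bar> < 1 / real (Suc j)"
      by (auto simp: eventually_sequentially)
    obtain n where "n \<ge> m" "t \<in> U n j"
      using t by (auto simp: W_def)
    then have "1 / real (Suc j) < \<bar>G n t\<bar>"
      using interior_subset unfolding U_def by blast
    then show False
      using m[OF \<open>n \<ge> m\<close>] by simp
  qed
  have "countable ((W j - A) \<inter> P)" for j
  proof (rule cond)
    have "gdelta_in euclidean (W j)"
      unfolding W_def
      by (intro gdelta_in_Inter) (auto intro!: open_imp_gdelta_in simp: U_def simp flip: open_openin)
    moreover have "fsigma_in euclidean (\<Union>a\<in>A. {a})"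
      using \<open>countable A\<close> by (intro fsigma_in_Union) (auto intro!: closed_imp_fsigma_in)
    ultimately show "gdelta_in euclidean (W j - A)"
      using gdelta_in_diff by fastforce
  qed (use internal in blast)
  then have "countable ((\<Union>j. (W j - A) \<inter> P) \<union> A \<union> D)"
    using \<open>countable A\<close> \<open>countable D\<close> by (intro countable_Un countable_UN) auto
  moreover have "{t \<in> P. \<not> (\<lambda>n. G n t) \<longlonglongrightarrow> 0} \<subseteq> (\<Union>j. (W j - A) \<inter> P) \<union> A \<union> D"
  proof (intro subsetI, elim CollectE conjE)
    fix t assume "t \<in> P" and lim: "\<not> (\<lambda>n. G n t) \<longlonglongrightarrow> 0"
    show "t \<in> (\<Union>j. (W j - A) \<inter> P) \<union> A \<union> D"
    proof (cases "t \<in> A \<union> D")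
      case False
      obtain e where "e > 0" and e: "\<And>m. \<exists>n\<ge>m. e \<le> \<bar>G n t\<bar>"
        using lim by (auto simp: lim_sequentially dist_real_def not_less)
      obtain j where j: "1 / real (Suc j) < e"
        using \<open>e > 0\<close> by (rule nat_approx_posE)
      have "t \<in> U n j" if "e \<le> \<bar>G n t\<bar>" for n
      proof -
        have "isCont (\<lambda>x. \<bar>G n x\<bar>) t"
          using False by (auto simp: D_def intro!: continuous_intros)
        then have "((\<lambda>x. \<bar>G n x\<bar>) \<longlongrightarrow> \<bar>G n t\<bar>) (nhds t)"
          by (simp add: isCont_def tendsto_nhds_iff)
        moreover have "1 / real (Suc j) < \<bar>G n t\<bar>"
          using that j by linarith
        ultimately have "\<forall>\<^sub>F x in nhds t. 1 / real (Suc j) < \<bar>G n x\<bar>"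
          by (rule order_tendstoD(1))
        then show ?thesis
          by (auto simp: U_def eventually_nhds interior_def subset_iff)
      qed
      then have "t \<in> W j"
        using e unfolding W_def by fastforce
      then show ?thesis
        using False \<open>t \<in> P\<close> by blast
    qed auto
  qed
  ultimately show ?thesis
    unfolding G_def using countable_subset by blast
qed

text \<open>
  The indicator of \<open>{..<t}\<close> differs from a continuous function, on which the functionals tend to
  zero, by a function living between \<open>t\<close> and the next element of \<open>F\<close>.  So up to a vanishing
  error the sum is one over functions with disjoint supports.
\<close>

lemma eventually_sum_prefix_le:
  fixes N :: "nat \<Rightarrow> ('l::linorder_topology \<Rightarrow> real) \<Rightarrow> real"
  assumes compact: "compact (UNIV :: 'l set)"
    and bf: "\<And>n. bounded_functional (N n) M"
    and null: "\<And>g. continuous_on UNIV g \<Longrightarrow> bounded (range g) \<Longrightarrow> (\<lambda>n. N n g) \<longlonglongrightarrow> 0"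
    and "finite F"
  shows "\<forall>\<^sub>F n in sequentially. (\<Sum>t\<in>F. \<bar>N n (indicator {..<t})\<bar>) \<le> M + 1"
proof -
  obtain g :: "'l \<Rightarrow> 'l \<Rightarrow> real" where cont: "\<And>t. continuous_on UNIV (g t)"
    and range: "\<And>t x. 0 \<le> g t x \<and> g t x \<le> 1" and one: "\<And>t x. x \<le> t \<Longrightarrow> g t x = 1"
    and zero: "\<And>t s x. s \<in> F \<Longrightarrow> t < s \<Longrightarrow> s \<le> x \<Longrightarrow> g t x = 0"
    using step_function[OF compact \<open>finite F\<close>] by metis
  define v where "v t x = g t x * indicator {t..} x" for t x
  have bdd: "bounded (range (g t))" "bounded (range (v t))" for t
    using range[of t] by (auto simp: v_def bounded_iff indicator_def intro!: exI[of _ 1])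
  have v: "(\<Sum>t\<in>F. \<bar>N n (v t)\<bar>) \<le> M" for n
  proof (rule bounded_functional.sum_abs_disjoint_le[OF bf \<open>finite F\<close>])
    show "\<bar>v t x\<bar> \<le> 1" for t x
      using range[of t x] by (simp add: v_def indicator_def)
    show "v s x = 0 \<or> v t x = 0" if "s \<in> F" "t \<in> F" "s \<noteq> t" for s t x
      using zero[OF that(1), of t x] zero[OF that(2), of s x] that(3)
      by (cases s t rule: linorder_cases) (auto simp: v_def indicator_def)
  qed
  have split: "N n (g t) = N n (indicator {..<t}) + N n (v t)" for n t
  proof -
    interpret bounded_functional "N n" M by (rule bf)
    have "g t = (\<lambda>x. indicator {..<t} x + v t x)"
      using one[of _ t] by (force simp: v_def indicator_def)
    then show ?thesis
      using add[OF bounded_indicator bdd(2)] by metis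
  qed
  have "(\<lambda>n. \<Sum>t\<in>F. \<bar>N n (g t)\<bar>) \<longlonglongrightarrow> 0"
    using null[OF cont bdd(1)] by (intro tendsto_null_sum tendsto_rabs_zero)
  then have "\<forall>\<^sub>F n in sequentially. (\<Sum>t\<in>F. \<bar>N n (g t)\<bar>) < 1"
    by (rule order_tendstoD) simp
  then show ?thesis
  proof eventually_elim
    case (elim n)
    have "(\<Sum>t\<in>F. \<bar>N n (indicator {..<t})\<bar>) \<le> (\<Sum>t\<in>F. \<bar>N n (v t)\<bar> + \<bar>N n (g t)\<bar>)"
      using split[of n] by (intro sum_mono) auto
    also have "\<dots> = (\<Sum>t\<in>F. \<bar>N n (v t)\<bar>) + (\<Sum>t\<in>F. \<bar>N n (g t)\<bar>)"
      by (rule sum.distrib)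
    finally show ?case
      using v[of n] elim by linarith
  qed
qed

section \<open>Countable sets of jumps yield extensions\<close>

text \<open>
  Surjectivity is encoded in the presence of the end points \<open>a t\<close> and \<open>b t\<close> of every fibre; they exist
  because fibres are compact.
\<close>

locale fibre_ends =
  fixes \<phi> :: "'k::linorder_topology \<Rightarrow> 'l::linorder_topology" and a b :: "'l \<Rightarrow> 'k"
  assumes compact_K: "compact (UNIV :: 'k set)" and compact_L: "compact (UNIV :: 'l set)"
    and cont: "continuous_on UNIV \<phi>" and mono: "mono \<phi>"
    and phi_a [simp]: "\<phi> (a t) = t" and phi_b [simp]: "\<phi> (b t) = t"
    and a_le: "a (\<phi> x) \<le> x" and le_b: "x \<le> b (\<phi> x)"
begin

lemma a_le_b: "a t \<le> b t"
  using a_le[of "b t"] by simp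

lemma b_less_a: "s < t \<Longrightarrow> b s < a t"
  using monoD[OF mono, of "a t" "b s"] by (auto simp flip: not_le)

lemma Q_iff: "t \<in> Q \<phi> \<longleftrightarrow> a t < b t"
proof
  assume "t \<in> Q \<phi>"
  then obtain x y where "\<phi> x = t" "\<phi> y = t" "x \<noteq> y"
    by (auto simp: Q_def)
  then show "a t < b t"
    using a_le[of x] le_b[of x] a_le[of y] le_b[of y] by force
next
  assume "a t < b t"
  then show "t \<in> Q \<phi>"
    unfolding Q_def by (intro CollectI bexI[of _ "a t"] bexI[of _ "b t"]) auto
qed

text \<open>
  Extensions are built from evaluations at end points of fibres, so a function on the domain of
  \<open>\<phi>\<close> matters only through its restriction to this compact set, on which every nontrivial fibre
  becomes a jump.
\<close>

definition ends :: "'k set"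
  where "ends = range a \<union> range b"

lemma compact_ends: "compact ends"
proof -
  have "- ends = (\<Union>t. {a t<..<b t})"
  proof (intro set_eqI iffI)
    fix x assume x: "x \<in> - ends"
    then have "x \<noteq> a (\<phi> x)" "x \<noteq> b (\<phi> x)"
      unfolding ends_def by (metis ComplD UnI1 UnI2 rangeI)+
    then show "x \<in> (\<Union>t. {a t<..<b t})"
      using a_le[of x] le_b[of x] by (intro UN_I[of "\<phi> x"]) auto
  next
    fix x assume "x \<in> (\<Union>t. {a t<..<b t})"
    then obtain t where t: "a t < x" "x < b t"
      by auto
    then have "\<phi> x = t"
      using monoD[OF mono, of "a t" x] monoD[OF mono, of x "b t"] by (intro order_antisym) simp_all
    then show "x \<in> - ends"
      using t by (auto simp: ends_def)
  qed
  then have "closed ends"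
    unfolding closed_def by auto
  then show ?thesis
    using compact_Int_closed[OF compact_K] by simp
qed

lemma gap_at_Q:
  assumes "t \<in> Q \<phi>" "x \<in> ends"
  shows "x \<le> a t \<longleftrightarrow> x < b t"
proof (cases "\<phi> x" t rule: linorder_cases)
  case less
  then show ?thesis
    using b_less_a[OF less] le_b[of x] a_le_b[of t] by auto
next
  case equal
  then show ?thesis
    using assms by (auto simp: ends_def Q_iff)
next
  case greater
  then show ?thesis
    using b_less_a[OF greater] a_le[of x] a_le_b[of t] by auto
qed

lemma continuous_on_ends_indicator:
  assumes "t \<in> Q \<phi>"
  shows "continuous_on ends (indicator {..a t} :: 'k \<Rightarrow> real)"
proof -
  let ?f = "indicator {..a t} :: 'k \<Rightarrow> real"
  have split: "ends = (ends \<inter> {..<b t}) \<union> (ends \<inter> {a t<..})"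
    using Q_iff assms by auto
  have "continuous_on (ends \<inter> {..<b t}) ?f"
    by (rule continuous_on_eq[of _ "\<lambda>_. 1"]) (use gap_at_Q[OF assms] in auto)
  moreover have "continuous_on (ends \<inter> {a t<..}) ?f"
    by (rule continuous_on_eq[of _ "\<lambda>_. 0"]) auto
  moreover have "openin (top_of_set ends) (ends \<inter> {..<b t})" "openin (top_of_set ends) (ends \<inter> {a t<..})"
    by (auto intro: openin_open_Int)
  ultimately have "continuous_on ((ends \<inter> {..<b t}) \<union> (ends \<inter> {a t<..})) ?f"
    using split by (intro continuous_on_Un_local_open) simp_all
  then show ?thesis
    using split by simp
qed

text \<open>
  On the end points, continuous functions are uniform limits of combinations of functions
  pulled back from the image and of such functions cut off at jumps.  Allowing a cut-off factor in
  every summand makes the set closed under products.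
\<close>

inductive_set steps :: "('k \<Rightarrow> real) set" where
  base: "continuous_on UNIV g \<Longrightarrow> J = UNIV \<or> (\<exists>t\<in>Q \<phi>. J = {..a t}) \<Longrightarrow> (\<lambda>x. g (\<phi> x) * indicator J x) \<in> steps"
| plus: "f \<in> steps \<Longrightarrow> h \<in> steps \<Longrightarrow> (\<lambda>x. f x + h x) \<in> steps"

lemma steps_mult_base:
  assumes "h \<in> steps" "continuous_on UNIV g" "J = UNIV \<or> (\<exists>t\<in>Q \<phi>. J = {..a t})"
  shows "(\<lambda>x. g (\<phi> x) * indicator J x * h x) \<in> steps"
  using assms(1)
proof induction
  case (base g' J')
  have "J \<inter> J' = UNIV \<or> (\<exists>t\<in>Q \<phi>. J \<inter> J' = {..a t})"
  proof (cases "J = UNIV \<or> J' = UNIV")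
    case False
    then obtain s t where st: "s \<in> Q \<phi>" "t \<in> Q \<phi>" "J = {..a s}" "J' = {..a t}"
      using assms(3) base(2) by blast
    then show ?thesis
      by (cases "a s \<le> a t") (force simp: not_le)+
  qed (use assms(3) base(2) in auto)
  then have "(\<lambda>x. (g (\<phi> x) * g' (\<phi> x)) * indicator (J \<inter> J') x) \<in> steps"
    using assms(2) base(1) by (intro steps.base[of "\<lambda>x. g x * g' x"] continuous_intros)
  then show ?case
    by (simp add: indicator_inter_arith mult_ac)
next
  case (plus f h)
  then show ?case
    using steps.plus by (simp add: distrib_left)
qed

lemma steps_mult: "f \<in> steps \<Longrightarrow> h \<in> steps \<Longrightarrow> (\<lambda>x. f x * h x) \<in> steps"
proof (induction rule: steps.induct)
  case (base g J)
  then show ?case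
    by (intro steps_mult_base)
next
  case (plus f f')
  then show ?case
    using steps.plus by (simp add: distrib_right)
qed

lemma continuous_on_steps: "f \<in> steps \<Longrightarrow> continuous_on ends f"
proof (induction rule: steps.induct)
  case (base g J)
  have "continuous_on ends (\<lambda>x. g (\<phi> x))"
    using continuous_on_compose[OF cont, of g] continuous_on_subset[OF base(1)]
    by (auto simp: o_def intro: continuous_on_subset)
  moreover have "continuous_on ends (indicator J :: 'k \<Rightarrow> real)"
    using base(2) continuous_on_ends_indicator by auto
  ultimately show ?case
    by (rule continuous_on_mult)
next
  case (plus f h)
  then show ?case
    by (intro continuous_on_add)
qed

lemma bounded_comp_b_steps: "f \<in> steps \<Longrightarrow> bounded (range (\<lambda>t. f (b t)))"
proof -
  assume "f \<in> steps"
  then have "compact (f ` ends)"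
    using compact_ends continuous_on_steps compact_continuous_image by blast
  then show ?thesis
    by (rule bounded_subset[OF compact_imp_bounded]) (auto simp: ends_def)
qed

text \<open>
  Points in different fibres are separated by pulling back an Urysohn function, and the two end
  points of one fibre by the cut-off between them, so the Stone-Weierstrass theorem applies.
\<close>

lemma steps_dense:
  assumes "continuous_on UNIV f" "e > 0"
  shows "\<exists>h\<in>steps. \<forall>x\<in>ends. \<bar>f x - h x\<bar> < e"
proof -
  interpret function_ring_on steps ends
  proof
    show "(\<lambda>_. c) \<in> steps" for c
      using steps.base[of "\<lambda>_. c" UNIV] by simp
    show "\<exists>f\<in>steps. f x \<noteq> f y" if xy: "x \<in> ends" "y \<in> ends" "x \<noteq> y" for x y
    proof (cases "\<phi> x = \<phi> y")
      case False
      then obtain g :: "'l \<Rightarrow> real" where "continuous_on UNIV g" "g (\<phi> x) = 1" "g (\<phi> y) = 0"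
        using Urysohn_compact[OF compact_L, of "{\<phi> x}" "{\<phi> y}"] by auto
      then show ?thesis
        using steps.base[of g UNIV] by (intro bexI[of _ "\<lambda>x. g (\<phi> x) * indicator UNIV x"]) auto
    next
      case True
      define t where "t = \<phi> x"
      have "{x, y} = {a t, b t}" and t: "t \<in> Q \<phi>"
        using xy True by (auto simp: ends_def t_def Q_def)
      moreover have "a t < b t"
        using t Q_iff by simp
      ultimately have "indicator {..a t} x \<noteq> (indicator {..a t} y :: real)"
        by (auto simp: indicator_def doubleton_eq_iff)
      moreover have "(\<lambda>x. 1 * indicator {..a t} x) \<in> steps"
        using steps.base[of "\<lambda>_. 1" "{..a t}"] t by auto
      ultimately show ?thesis
        by (intro bexI[of _ "\<lambda>x. 1 * indicator {..a t} x"]) auto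
    qed
  qed (use compact_ends continuous_on_steps steps_mult in \<open>auto intro: steps.plus\<close>)
  show ?thesis
    using Stone_Weierstrass_basic assms continuous_on_subset by blast
qed

text \<open>
  Evaluating \<open>N n\<close> at upper end points of fibres extends the given functional, but on the cut-off at
  \<open>t\<close> it yields \<open>G n t\<close>.  Differences of evaluations at the two ends of a fibre vanish on
  pulled back functions and detect exactly this cut-off, so subtracting them with weights
  \<open>G n t\<close> over \<open>H n\<close> repairs the limit; the bound \<open>C\<close> on the weights keeps the functionals uniformly
  bounded, which carries the convergence over from the dense set of step functions.
\<close>

lemma corrected_functionals_null:
  assumes bf: "\<And>n. bounded_functional (N n) M"
    and null: "\<And>g. continuous_on UNIV g \<Longrightarrow> bounded (range g) \<Longrightarrow> (\<lambda>n. N n g) \<longlonglongrightarrow> 0"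
    and G: "\<And>n t. G n t = N n (indicator {..<t})"
    and fin: "\<And>n. finite (H n)" and sub: "\<And>n. H n \<subseteq> Q \<phi>" and sum_le: "\<And>n. (\<Sum>t\<in>H n. \<bar>G n t\<bar>) \<le> C"
    and covered: "\<And>t. t \<in> Q \<phi> \<Longrightarrow> (\<lambda>n. G n t) \<longlonglongrightarrow> 0 \<or> (\<forall>\<^sub>F n in sequentially. t \<in> H n)"
    and f: "continuous_on UNIV f"
  shows "(\<lambda>n. N n (\<lambda>t. f (b t)) - (\<Sum>t\<in>H n. G n t * (f (a t) - f (b t)))) \<longlonglongrightarrow> 0"
proof -
  define S where "S n f = N n (\<lambda>t. f (b t)) - (\<Sum>t\<in>H n. G n t * (f (a t) - f (b t)))" for n and f :: "'k \<Rightarrow> real"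
  have S_steps: "(\<lambda>n. S n h) \<longlonglongrightarrow> 0" if "h \<in> steps" for h
    using that
  proof induction
    case (base g J)
    have bdd: "bounded (range g)"
      using compact_continuous_image[OF base(1) compact_L] by (rule compact_imp_bounded)
    show ?case
      using base(2)
    proof (elim disjE bexE)
      assume "J = UNIV"
      then show ?thesis
        using null[OF base(1) bdd] by (simp add: S_def)
    next
      fix t assume t: "t \<in> Q \<phi>" and J: "J = {..a t}"
      \<comment> \<open>On the end points, \<open>g (\<phi> x)\<close> cut off at \<open>a t\<close> is the cut-off of the constant \<open>g t\<close> plus the pullback of the continuous function \<open>w\<close>.\<close>
      define w where "w s = (if s \<le> t then g s - g t else 0)" for s
      have cont_w: "continuous_on UNIV w"
      proof -
        have "continuous_on ({..t} \<union> {t..}) w"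
          unfolding w_def using base(1)
          by (intro continuous_on_cases continuous_intros) (auto intro: continuous_on_subset)
        moreover have "{..t} \<union> {t..} = UNIV"
          by auto
        ultimately show ?thesis by simp
      qed
      have bdd_w: "bounded (range w)"
        using compact_continuous_image[OF cont_w compact_L] by (rule compact_imp_bounded)
      have b_le: "b s \<le> a t \<longleftrightarrow> s < t" for s
        using b_less_a[of s t] b_less_a[of t s] a_le_b[of s] t Q_iff[of t]
        by (cases s t rule: linorder_cases) auto
      have a_le': "a s \<le> a t \<longleftrightarrow> s \<le> t" for s
        using b_less_a[of s t] b_less_a[of t s] a_le_b[of s] a_le_b[of t]
        by (cases s t rule: linorder_cases) auto
      have "N n (\<lambda>s. g s * indicator {..a t} (b s)) = g t * G n t + N n w" for n
      proof -
        interpret bounded_functional "N n" M by (rule bf)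
        have "(\<lambda>s. g s * indicator {..a t} (b s)) = (\<lambda>s. g t * indicator {..<t} s + w s)"
          by (auto simp: w_def indicator_def b_le fun_eq_iff)
        moreover have "bounded (range (\<lambda>s. g t * indicator {..<t} s))"
          by (auto simp: bounded_iff indicator_def)
        ultimately show ?thesis
          using add[OF _ bdd_w] scale[OF bounded_indicator] by (simp add: G)
      qed
      moreover have "(\<Sum>s\<in>H n. G n s * (g s * indicator {..a t} (a s) - g s * indicator {..a t} (b s)))
          = (if t \<in> H n then G n t * g t else 0)" for n
      proof -
        have "(\<Sum>s\<in>H n. G n s * (g s * indicator {..a t} (a s) - g s * indicator {..a t} (b s)))
          = (\<Sum>s\<in>H n. if s = t then G n t * g t else 0)"
          by (intro sum.cong) (auto simp: indicator_def b_le a_le')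
        then show ?thesis
          using fin by (simp add: sum.delta')
      qed
      ultimately have S: "S n (\<lambda>x. g (\<phi> x) * indicator J x) = 
          N n w + (if t \<in> H n then 0 else g t * G n t)" for n
        by (simp add: S_def J)
      have "(\<lambda>n. if t \<in> H n then 0 else g t * G n t) \<longlonglongrightarrow> 0"
        using covered[OF t]
      proof
        assume "(\<lambda>n. G n t) \<longlonglongrightarrow> 0"
        then have "(\<lambda>n. g t * G n t) \<longlonglongrightarrow> 0"
          by (rule tendsto_mult_right_zero)
        then show ?thesis
          by (rule Lim_null_comparison[OF _ tendsto_rabs_zero, rotated]) auto
      next
        assume "\<forall>\<^sub>F n in sequentially. t \<in> H n"
        then show ?thesis
          by (intro tendsto_eventually) (auto elim: eventually_mono)
      qed
      then show ?thesis
        using tendsto_add[OF null[OF cont_w bdd_w]] unfolding S by fastforce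
    qed
  next
    case (plus f h)
    have "S n (\<lambda>x. f x + h x) = S n f + S n h" for n
      using bounded_functional.add[OF bf bounded_comp_b_steps[OF plus(1)] bounded_comp_b_steps[OF plus(2)]]
      by (simp add: S_def algebra_simps sum.distrib sum_subtractf)
    then show ?case
      using tendsto_add[OF plus.IH] by simp
  qed
  have C: "C \<ge> 0"
    by (rule order_trans[OF sum_nonneg sum_le[of 0]]) simp
  have M: "M \<ge> 0"
    using bf bounded_functional.nonneg by blast
  have bdd_f: "bounded (range (\<lambda>t. f (b t)))"
    by (rule bounded_subset[OF compact_imp_bounded[OF compact_continuous_image[OF f compact_K]]]) auto
  have "(\<lambda>n. S n f) \<longlonglongrightarrow> 0"
  proof (rule tendstoI)
    fix e :: real assume "e > 0"
    \<comment> \<open>The two functionals differ by at most \<open>(M + 2 * C) * e'\<close> if the functions differ by at most \<open>e'\<close> on the end points.\<close>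
    define e' where "e' = e / (M + 2 * C + 1) / 2"
    have "e' > 0"
      using M C \<open>e > 0\<close> by (simp add: e'_def)
    have e': "(M + 2 * C) * e' < e / 2"
      using M C \<open>e > 0\<close> by (simp add: e'_def field_simps)
    obtain h where h: "h \<in> steps" "\<And>x. x \<in> ends \<Longrightarrow> \<bar>f x - h x\<bar> < e'"
      using steps_dense[OF f \<open>e' > 0\<close>] by auto
    have ha: "\<bar>f (a t) - h (a t)\<bar> \<le> e'" and hb: "\<bar>f (b t) - h (b t)\<bar> \<le> e'" for t
      using h(2)[of "a t"] h(2)[of "b t"] by (auto simp: ends_def)
    have "\<bar>S n f - S n h\<bar> \<le> (M + 2 * C) * e'" for n
    proof -
      interpret bounded_functional "N n" M by (rule bf)
      have "S n f - S n h = N n (\<lambda>t. f (b t) - h (b t))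
          - (\<Sum>t\<in>H n. G n t * ((f (a t) - h (a t)) - (f (b t) - h (b t))))"
        unfolding S_def diff[OF bdd_f bounded_comp_b_steps[OF h(1)]]
        by (simp add: sum_subtractf algebra_simps sum.distrib)
      moreover have "\<bar>N n (\<lambda>t. f (b t) - h (b t))\<bar> \<le> M * e'"
        by (rule bound) (rule hb)
      moreover have "\<bar>\<Sum>t\<in>H n. G n t * ((f (a t) - h (a t)) - (f (b t) - h (b t)))\<bar>
          \<le> (\<Sum>t\<in>H n. \<bar>G n t\<bar> * (2 * e'))"
      proof (rule order_trans[OF sum_abs sum_mono])
        fix t
        have "\<bar>(f (a t) - h (a t)) - (f (b t) - h (b t))\<bar> \<le> 2 * e'"
          using ha[of t] hb[of t] by linarith
        then show "\<bar>G n t * ((f (a t) - h (a t)) - (f (b t) - h (b t)))\<bar> \<le> \<bar>G n t\<bar> * (2 * e')"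
          by (simp add: abs_mult mult_left_mono)
      qed
      moreover have "(\<Sum>t\<in>H n. \<bar>G n t\<bar> * (2 * e')) \<le> C * (2 * e')"
        using sum_le[of n] \<open>e' > 0\<close> by (simp flip: sum_distrib_right)
      ultimately show ?thesis
        by (simp add: algebra_simps)
    qed
    moreover have "\<forall>\<^sub>F n in sequentially. \<bar>S n h\<bar> < e / 2"
      using tendstoD[OF S_steps[OF h(1)], of "e / 2"] \<open>e > 0\<close> by (simp add: dist_real_def)
    ultimately show "\<forall>\<^sub>F n in sequentially. dist (S n f) 0 < e"
    proof (elim eventually_mono)
      fix n assume "\<bar>S n h\<bar> < e / 2"
      moreover have "\<bar>S n f - S n h\<bar> \<le> (M + 2 * C) * e'"
        by fact
      ultimately show "dist (S n f) 0 < e"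
        using e' by (simp add: dist_real_def)
    qed
  qed
  then show ?thesis
    by (simp add: S_def)
qed

text \<open>
  The weights are only needed at the countably many jumps where \<open>G n t\<close> does not tend to zero, and
  finitely many of them at a time can be chosen with total mass at most \<open>M + 1\<close>.
\<close>

lemma c0_extension_if_countable:
  assumes cond: "\<And>C. gdelta_in euclidean C \<Longrightarrow> \<forall>x\<in>C. internal_point x \<Longrightarrow> countable (C \<inter> Q \<phi>)"
  shows "has_c0_extension_property \<phi>"
  unfolding has_c0_extension_property_def c0_extension_property_in_def
proof (intro allI impI)
  fix T assume T: "bounded_operator_on (range (pullback \<phi>)) c0 T"
  obtain M N where bf: "\<And>n. bounded_functional (N n) M"
    and N_T: "\<And>n f. N n (apply_bcontfun f) = apply_bcontfun (T (pullback \<phi> f)) n"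
    and null: "\<And>g. continuous_on UNIV g \<Longrightarrow> bounded (range g) \<Longrightarrow> (\<lambda>n. N n g) \<longlonglongrightarrow> 0"
    using c0_operator_functionals[OF bounded_operator_on_pullback[OF cont T]] by metis
  define G where "G n t = N n (indicator {..<t})" for n t
  define B where "B = {t \<in> Q \<phi>. \<not> (\<lambda>n. G n t) \<longlonglongrightarrow> 0}"
  have M: "M \<ge> 0"
    using bf bounded_functional.nonneg by blast
  have "countable B"
    unfolding B_def G_def by (rule countable_non_null_points[OF bf null cond])
  moreover have "\<forall>\<^sub>F n in sequentially. (\<Sum>t\<in>F. \<bar>G n t\<bar>) \<le> M + 1" if "finite F" for F
    unfolding G_def by (rule eventually_sum_prefix_le[OF compact_L bf null that])
  ultimately have "\<exists>H. (\<forall>n. finite (H n) \<and> H n \<subseteq> B \<and> (\<Sum>t\<in>H n. \<bar>G n t\<bar>) \<le> M + 1) \<and>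
      (\<forall>t\<in>B. \<forall>\<^sub>F n in sequentially. t \<in> H n)"
    using M by (intro exhausting_finite_subsets) auto
  then obtain H where H: "\<And>n. finite (H n)" "\<And>n. H n \<subseteq> B" 
    "\<And>n. (\<Sum>t\<in>H n. \<bar>G n t\<bar>) \<le> M + 1" "\<And>t. t \<in> B \<Longrightarrow> \<forall>\<^sub>F n in sequentially. t \<in> H n"
    by blast
  define S where "S n f = N n (\<lambda>t. apply_bcontfun f (b t)) - 
    (\<Sum>t\<in>H n. G n t * (apply_bcontfun f (a t) - apply_bcontfun f (b t)))" for n f
  have bdd: "bounded (range (\<lambda>t. apply_bcontfun f (b t)))" for f :: "'k \<Rightarrow>\<^sub>C real"
    by (rule bounded_subset[OF bounded_apply_bcontfun[of f]]) auto
  have lin: "linear (S n)" for n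
  proof (rule linearI)
    show "S n (f + g) = S n f + S n g" for f g
      using bounded_functional.add[OF bf bdd bdd]
      by (simp add: S_def algebra_simps sum.distrib sum_subtractf)
    show "S n (c *\<^sub>R f) = c *\<^sub>R S n f" for c f
      using bounded_functional.scale[OF bf bdd]
      by (simp add: S_def algebra_simps sum_distrib_left)
  qed
  have bound: "\<bar>S n f\<bar> \<le> (M + 2 * (M + 1)) * norm f" for n f
  proof -
    have f: "\<bar>apply_bcontfun f x\<bar> \<le> norm f" for x
      using norm_bounded[of f x] by simp
    have "\<bar>N n (\<lambda>t. apply_bcontfun f (b t))\<bar> \<le> M * norm f"
      by (rule bounded_functional.bound[OF bf]) (rule f)
    moreover have "\<bar>\<Sum>t\<in>H n. G n t * (apply_bcontfun f (a t) - apply_bcontfun f (b t))\<bar>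
        \<le> (\<Sum>t\<in>H n. \<bar>G n t\<bar> * (2 * norm f))"
    proof (rule order_trans[OF sum_abs sum_mono])
      fix t
      have "\<bar>apply_bcontfun f (a t) - apply_bcontfun f (b t)\<bar> \<le> 2 * norm f"
        using f[of "a t"] f[of "b t"] by linarith
      then show "\<bar>G n t * (apply_bcontfun f (a t) - apply_bcontfun f (b t))\<bar> \<le> \<bar>G n t\<bar> * (2 * norm f)"
        by (simp add: abs_mult mult_left_mono)
    qed
    moreover have "(\<Sum>t\<in>H n. \<bar>G n t\<bar> * (2 * norm f)) \<le> (M + 1) * (2 * norm f)"
      using H(3)[of n] by (simp flip: sum_distrib_right add: mult_right_mono)
    ultimately show ?thesis
      unfolding S_def by (simp add: algebra_simps)
  qed
  have S_null: "(\<lambda>n. S n f) \<longlonglongrightarrow> 0" for f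
    unfolding S_def
    by (rule corrected_functionals_null[OF bf null G_def H(1) _ H(3)])
       (use H(2,4) in \<open>auto simp: B_def\<close>)
  let ?S = "\<lambda>f. Bcontfun (\<lambda>n. S n f)"
  have "?S y = T y" if y_range: "y \<in> range (pullback \<phi>)" for y
  proof -
    obtain f where y: "y = pullback \<phi> f"
      using y_range by blast
    have "S n y = apply_bcontfun (T y) n" for n
      using N_T[of n f] by (simp add: S_def y apply_pullback[OF cont])
    then show ?thesis
      by (simp add: apply_bcontfun_inverse)
  qed
  moreover have "bounded_operator_on UNIV c0 ?S"
    by (rule bounded_operator_on_c0I(1)[OF lin bound S_null])
  ultimately show "\<exists>S. bounded_operator_on UNIV c0 S \<and> (\<forall>y\<in>range (pullback \<phi>). S y = T y)"
    by blast
qed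

end

section \<open>Extensions force countable sets of jumps\<close>

lemma internal_point_interval:
  fixes t :: "'l::linorder_topology"
  assumes "internal_point t" "open W" "t \<in> W"
  shows "\<exists>p q. p < t \<and> t < q \<and> {p..q} \<subseteq> W"
proof -
  obtain u v where "u < t" "t < v"
    using assms(1) by (auto simp: internal_point_def not_le)
  obtain q' where q': "t < q'" "{t..<q'} \<subseteq> W"
    using open_right[OF assms(2,3) \<open>t < v\<close>] by blast
  obtain p' where p': "p' < t" "{p'<..t} \<subseteq> W"
    using open_left[OF assms(2,3) \<open>u < t\<close>] by blast
  obtain p where p: "p' < p" "p < t"
    using assms(1) p'(1) unfolding internal_point_def by force
  obtain q where q: "t < q" "q < q'"
    using assms(1) q'(1) unfolding internal_point_def by force
  have "{p..q} \<subseteq> {p'<..t} \<union> {t..<q'}"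
    using p q by auto
  then show ?thesis
    using p q p'(2) q'(2) by blast
qed

lemma compact_line_has_sup:
  fixes A :: "'l::linorder_topology set"
  assumes "compact (UNIV :: 'l set)" "A \<noteq> {}"
  shows "\<exists>s. (\<forall>x\<in>A. x \<le> s) \<and> (\<forall>u. (\<forall>x\<in>A. x \<le> u) \<longrightarrow> s \<le> u)"
proof -
  have "compact (closure A)"
    using compact_Int_closed[OF assms(1) closed_closure[of A]] by simp
  then obtain s where s: "s \<in> closure A" "\<forall>x\<in>closure A. x \<le> s"
    using compact_attains_sup assms(2) by (metis closure_eq_empty)
  moreover have "s \<le> u" if "\<forall>x\<in>A. x \<le> u" for u
    using closure_minimal[of A "{..u}"] that s(1) by auto
  ultimately show ?thesis
    using closure_subset by blast
qed

lemma compact_line_has_inf: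
  fixes A :: "'l::linorder_topology set"
  assumes "compact (UNIV :: 'l set)" "A \<noteq> {}"
  shows "\<exists>s. (\<forall>x\<in>A. s \<le> x) \<and> (\<forall>u. (\<forall>x\<in>A. u \<le> x) \<longrightarrow> u \<le> s)"
proof -
  have "compact (closure A)"
    using compact_Int_closed[OF assms(1) closed_closure[of A]] by simp
  then obtain s where s: "s \<in> closure A" "\<forall>x\<in>closure A. s \<le> x"
    using compact_attains_inf assms(2) by (metis closure_eq_empty)
  moreover have "u \<le> s" if "\<forall>x\<in>A. u \<le> x" for u
    using closure_minimal[of A "{u..}"] that s(1) by auto
  ultimately show ?thesis
    using closure_subset by blast
qed

text \<open>
  The order-convex component of \<open>t\<close> in \<open>W\<close>.  These are not topological components: in a line with
  jumps the latter can be single points.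
\<close>

definition order_component :: "'l::linorder set \<Rightarrow> 'l \<Rightarrow> 'l set"
  where "order_component W t = {s. {min s t..max s t} \<subseteq> W}"

lemma order_component_sym: "s \<in> order_component W t \<Longrightarrow> t \<in> order_component W s"
  by (simp add: order_component_def min.commute max.commute)

lemma order_component_subset: "order_component W t \<subseteq> W"
  by (auto simp: order_component_def subset_iff)

lemma order_component_trans:
  assumes "s \<in> order_component W t" "t \<in> order_component W u"
  shows "s \<in> order_component W u"
proof -
  have "{min s u..max s u} \<subseteq> {min s t..max s t} \<union> {min t u..max t u}"
    by (auto simp: min_def max_def split: if_splits)
  then show ?thesis
    using assms unfolding order_component_def by blast
qed

lemma order_component_convex:
  assumes "r \<in> order_component W t" "s \<in> order_component W t" "r \<le> w" "w \<le> s"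
  shows "w \<in> order_component W t"
proof -
  have "{min r s..max r s} \<subseteq> W"
    using order_component_trans[OF assms(1) order_component_sym[OF assms(2)]]
    by (simp add: order_component_def)
  moreover have "{min w s..max w s} \<subseteq> {min r s..max r s}"
    using assms(3,4) by (auto simp: min_def max_def split: if_splits)
  ultimately have "w \<in> order_component W s"
    unfolding order_component_def by blast
  then show ?thesis
    using assms(2) by (rule order_component_trans)
qed

text \<open>
  Near \<open>z\<close>, on its left, there is a point \<open>a\<close> that all late sets of the form \<open>U m\<close> minus the first
  \<open>m\<close> dense points avoid, so that no convex part of these sets passes it.  If \<open>z\<close> is approached from the
  left, \<open>a\<close> is a dense point; otherwise \<open>z\<close> is not internal, lies outside \<open>U m\<close> for all large \<open>m\<close>, and serves as its
  own barrier.
\<close>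

lemma barrier_left:
  fixes z :: "'l::linorder_topology" and U :: "nat \<Rightarrow> 'l set" and d :: "nat \<Rightarrow> 'l"
  assumes dense: "\<And>S. open S \<Longrightarrow> S \<noteq> {} \<Longrightarrow> \<exists>k. d k \<in> S"
    and escape: "\<not> internal_point z \<Longrightarrow> \<exists>m0. \<forall>m\<ge>m0. z \<notin> U m"
    and V: "open V" "z \<in> V"
  shows "\<exists>a m0 N. a \<le> z \<and> {a..z} \<subseteq> V \<and> open N \<and> z \<in> N \<and> N \<subseteq> {a..} \<and> (\<forall>m\<ge>m0. a \<notin> U m - d ` {..<m})"
proof (cases "\<exists>v. v < z")
  case True
  then obtain v where v: "v < z" "{v<..z} \<subseteq> V"
    using open_left[OF V] by blast
  show ?thesis
  proof (cases "{v<..<z} = {}")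
    case False
    then obtain k where k: "v < d k" "d k < z"
      using dense[of "{v<..<z}"] by auto
    have "d k \<notin> U m - d ` {..<m}" if "m \<ge> Suc k" for m
      using that by auto
    moreover have "{d k..z} \<subseteq> {v<..z}"
      using k by auto
    ultimately show ?thesis
      using k v(2) by (intro exI[of _ "d k"] exI[of _ "Suc k"] exI[of _ "{d k<..}"]) auto
  next
    case empty: True
    then have "\<not> internal_point z"
      using v by (auto simp: internal_point_def)
    then obtain m0 where "\<forall>m\<ge>m0. z \<notin> U m"
      using escape by blast
    moreover have "z \<le> x" if "v < x" for x
      using empty that by (metis greaterThanLessThan_iff empty_iff not_le)
    ultimately show ?thesis
      using v(1) V(2) by (intro exI[of _ z] exI[of _ m0] exI[of _ "{v<..}"]) auto
  qed
next
  case False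
  then have "\<not> internal_point z" and UNIV: "UNIV \<subseteq> {z..}"
    by (auto simp: internal_point_def not_less)
  then obtain m0 where "\<forall>m\<ge>m0. z \<notin> U m"
    using escape by blast
  then show ?thesis
    using UNIV V(2) by (intro exI[of _ z] exI[of _ m0] exI[of _ UNIV]) auto
qed

lemma barrier_right:
  fixes z :: "'l::linorder_topology" and U :: "nat \<Rightarrow> 'l set" and d :: "nat \<Rightarrow> 'l"
  assumes dense: "\<And>S. open S \<Longrightarrow> S \<noteq> {} \<Longrightarrow> \<exists>k. d k \<in> S"
    and escape: "\<not> internal_point z \<Longrightarrow> \<exists>m0. \<forall>m\<ge>m0. z \<notin> U m"
    and V: "open V" "z \<in> V"
  shows "\<exists>a m0 N. z \<le> a \<and> {z..a} \<subseteq> V \<and> open N \<and> z \<in> N \<and> N \<subseteq> {..a} \<and> (\<forall>m\<ge>m0. a \<notin> U m - d ` {..<m})"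
proof (cases "\<exists>v. z < v")
  case True
  then obtain v where v: "z < v" "{z..<v} \<subseteq> V"
    using open_right[OF V] by blast
  show ?thesis
  proof (cases "{z<..<v} = {}")
    case False
    then obtain k where k: "z < d k" "d k < v"
      using dense[of "{z<..<v}"] by auto
    have "d k \<notin> U m - d ` {..<m}" if "m \<ge> Suc k" for m
      using that by auto
    moreover have "{z..d k} \<subseteq> {z..<v}"
      using k by auto
    ultimately show ?thesis
      using k v(2) by (intro exI[of _ "d k"] exI[of _ "Suc k"] exI[of _ "{..<d k}"]) auto
  next
    case empty: True
    then have "\<not> internal_point z"
      using v by (auto simp: internal_point_def)
    then obtain m0 where "\<forall>m\<ge>m0. z \<notin> U m"
      using escape by blast
    moreover have "x \<le> z" if "x < v" for x
      using empty that by (metis greaterThanLessThan_iff empty_iff not_le)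
    ultimately show ?thesis
      using v(1) V(2) by (intro exI[of _ z] exI[of _ m0] exI[of _ "{..<v}"]) auto
  qed
next
  case False
  then have "\<not> internal_point z" and UNIV: "UNIV \<subseteq> {..z}"
    by (auto simp: internal_point_def not_less)
  then obtain m0 where "\<forall>m\<ge>m0. z \<notin> U m"
    using escape by blast
  then show ?thesis
    using UNIV V(2) by (intro exI[of _ z] exI[of _ m0] exI[of _ UNIV]) auto
qed

lemma barriers:
  fixes z :: "'l::linorder_topology" and U :: "nat \<Rightarrow> 'l set" and d :: "nat \<Rightarrow> 'l"
  assumes dense: "\<And>S. open S \<Longrightarrow> S \<noteq> {} \<Longrightarrow> \<exists>k. d k \<in> S"
    and escape: "\<not> internal_point z \<Longrightarrow> \<exists>m0. \<forall>m\<ge>m0. z \<notin> U m"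
    and V: "open V" "z \<in> V"
  shows "\<exists>a b m0 N. {a..b} \<subseteq> V \<and> open N \<and> z \<in> N \<and> N \<subseteq> {a..b} \<and>
    (\<forall>m\<ge>m0. a \<notin> U m - d ` {..<m} \<and> b \<notin> U m - d ` {..<m})"
proof -
  have "\<exists>a m0 N. a \<le> z \<and> {a..z} \<subseteq> V \<and> open N \<and> z \<in> N \<and> N \<subseteq> {a..} \<and> (\<forall>m\<ge>m0. a \<notin> U m - d ` {..<m})"
    by (rule barrier_left[OF dense escape V])
  then obtain a m1 N1 where a: "a \<le> z" "{a..z} \<subseteq> V" "open N1" "z \<in> N1" "N1 \<subseteq> {a..}"
    "\<forall>m\<ge>m1. a \<notin> U m - d ` {..<m}"
    by blast
  have "\<exists>b m0 N. z \<le> b \<and> {z..b} \<subseteq> V \<and> open N \<and> z \<in> N \<and> N \<subseteq> {..b} \<and> (\<forall>m\<ge>m0. b \<notin> U m - d ` {..<m})"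
    by (rule barrier_right[OF dense escape V])
  then obtain b m2 N2 where b: "z \<le> b" "{z..b} \<subseteq> V" "open N2" "z \<in> N2" "N2 \<subseteq> {..b}"
    "\<forall>m\<ge>m2. b \<notin> U m - d ` {..<m}"
    by blast
  have "{a..b} \<subseteq> {a..z} \<union> {z..b}"
    by auto
  then have "{a..b} \<subseteq> V"
    using a(2) b(2) by blast
  moreover have "N1 \<inter> N2 \<subseteq> {a..b}"
    using a(5) b(5) by auto
  ultimately show ?thesis
    using open_Int[OF a(3) b(3)] a(4,6) b(4,6)
    by - (rule exI[of _ a], rule exI[of _ b], rule exI[of _ "max m1 m2"], rule exI[of _ "N1 \<inter> N2"], simp)
qed

text \<open>
  By compactness it suffices to look near a point \<open>z\<close>.  Enclose \<open>z\<close> between two barriers \<open>a\<close> and \<open>b\<close> so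
  close that \<open>f\<close> varies by less than \<open>e\<close> in between.  A set \<open>I p\<close> with large oscillation that comes near
  \<open>z\<close> cannot fit between the barriers, so by convexity it contains one of them.  This is impossible at
  late levels, and at each of the finitely many early levels at most one of the disjoint sets contains
  a given point.
\<close>

lemma finite_large_oscillations:
  fixes U :: "nat \<Rightarrow> 'l::linorder_topology set" and d :: "nat \<Rightarrow> 'l" and I :: "nat \<times> nat \<Rightarrow> 'l set"
    and f :: "'l \<Rightarrow> real"
  assumes compact: "compact (UNIV :: 'l set)"
    and dense: "\<And>S. open S \<Longrightarrow> S \<noteq> {} \<Longrightarrow> \<exists>k. d k \<in> S"
    and escape: "\<And>z. \<not> internal_point z \<Longrightarrow> \<exists>m0. \<forall>m\<ge>m0. z \<notin> U m"
    and nonempty: "\<And>p. p \<in> P \<Longrightarrow> I p \<noteq> {}"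
    and sub: "\<And>m k. (m, k) \<in> P \<Longrightarrow> I (m, k) \<subseteq> U m - d ` {..<m}"
    and convex: "\<And>p r s w. p \<in> P \<Longrightarrow> r \<in> I p \<Longrightarrow> s \<in> I p \<Longrightarrow> r \<le> w \<Longrightarrow> w \<le> s \<Longrightarrow> w \<in> I p"
    and disj: "\<And>m k k' w. (m, k) \<in> P \<Longrightarrow> (m, k') \<in> P \<Longrightarrow> w \<in> I (m, k) \<Longrightarrow> w \<in> I (m, k') \<Longrightarrow> k = k'"
    and enclosed: "\<And>p a b. p \<in> P \<Longrightarrow> I p \<subseteq> {a..b} \<Longrightarrow> lo p \<in> {a..b} \<and> hi p \<in> {a..b}"
    and cont: "continuous_on UNIV f" and "e > 0"
  shows "finite {p \<in> P. e \<le> \<bar>f (lo p) - f (hi p)\<bar>}"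
proof -
  define Bad where "Bad = {p \<in> P. e \<le> \<bar>f (lo p) - f (hi p)\<bar>}"
  have "\<exists>N. open N \<and> z \<in> N \<and> finite {p \<in> Bad. I p \<inter> N \<noteq> {}}" for z
  proof -
    define V where "V = {w. \<bar>f w - f z\<bar> < e / 2}"
    have "open V"
      unfolding V_def by (intro open_Collect_less continuous_intros cont)
    moreover have "z \<in> V"
      using \<open>e > 0\<close> by (simp add: V_def)
    ultimately have "\<exists>a b m0 N. {a..b} \<subseteq> V \<and> open N \<and> z \<in> N \<and> N \<subseteq> {a..b} \<and>
        (\<forall>m\<ge>m0. a \<notin> U m - d ` {..<m} \<and> b \<notin> U m - d ` {..<m})"
      by (intro barriers[OF dense escape])
    then obtain a b m0 N where ab: "{a..b} \<subseteq> V" "open N" "z \<in> N" "N \<subseteq> {a..b}"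
      "\<forall>m\<ge>m0. a \<notin> U m - d ` {..<m} \<and> b \<notin> U m - d ` {..<m}"
      by blast
    define X where "X c m = {p. p \<in> P \<and> fst p = m \<and> c \<in> I p}" for c m
    have "finite (X c m)" for c m
    proof (cases "X c m = {}")
      case False
      then obtain p where p: "p \<in> X c m" by blast
      have "X c m \<subseteq> {p}"
      proof
        fix q assume "q \<in> X c m"
        then show "q \<in> {p}"
          using p disj[of m "snd p" "snd q" c] by (cases p; cases q) (auto simp: X_def)
      qed
      then show ?thesis
        by (rule finite_subset) simp
    qed simp
    moreover have "{p \<in> Bad. I p \<inter> N \<noteq> {}} \<subseteq> (\<Union>m<m0. X a m \<union> X b m)"
    proof (intro subsetI, elim CollectE conjE)
      fix p assume p: "p \<in> Bad" "I p \<inter> N \<noteq> {}"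
      then have "p \<in> P"
        by (simp add: Bad_def)
      obtain w where w': "w \<in> I p" "w \<in> N"
        using p(2) by blast
      then have w: "w \<in> I p" "a \<le> w" "w \<le> b"
        using ab(4) by auto
      have "a \<in> I p \<or> b \<in> I p"
      proof (rule ccontr)
        assume "\<not> (a \<in> I p \<or> b \<in> I p)"
        then have "I p \<subseteq> {a..b}"
          using convex[OF \<open>p \<in> P\<close>] w by (metis atLeastAtMost_iff linear subsetI)
        then have "lo p \<in> V" "hi p \<in> V"
          using enclosed[OF \<open>p \<in> P\<close>] ab(1) by blast+
        then have "\<bar>f (lo p) - f z\<bar> < e / 2" "\<bar>f (hi p) - f z\<bar> < e / 2"
          by (simp_all add: V_def)
        moreover have "e \<le> \<bar>f (lo p) - f (hi p)\<bar>"
          using p(1) by (simp add: Bad_def)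
        ultimately show False
          by linarith
      qed
      moreover have "fst p < m0"
        using calculation sub[of "fst p" "snd p"] ab(5) \<open>p \<in> P\<close>
        by (metis in_mono not_less prod.collapse)
      ultimately show "p \<in> (\<Union>m<m0. X a m \<union> X b m)"
        using \<open>p \<in> P\<close> by (auto simp: X_def)
    qed
    ultimately have "finite {p \<in> Bad. I p \<inter> N \<noteq> {}}"
      by (elim finite_subset) auto
    then show ?thesis
      using ab(2,3) by blast
  qed
  then have ex: "\<exists>N. open N \<and> z \<in> N \<and> finite {p \<in> Bad. I p \<inter> N \<noteq> {}}" for z .
  define N where "N z = (SOME N. open N \<and> z \<in> N \<and> finite {p \<in> Bad. I p \<inter> N \<noteq> {}})" for z
  have N: "open (N z) \<and> z \<in> N z \<and> finite {p \<in> Bad. I p \<inter> N z \<noteq> {}}" for z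
    unfolding N_def by (rule someI_ex[OF ex])
  have "UNIV \<subseteq> (\<Union>z. N z)"
    using N by blast
  then have "\<exists>Z. finite Z \<and> UNIV \<subseteq> (\<Union>z\<in>Z. N z)"
    using compactE_image[OF compact, of UNIV N] N by metis
  then obtain Z where Z: "finite Z" "UNIV \<subseteq> (\<Union>z\<in>Z. N z)"
    by blast
  have "Bad \<subseteq> (\<Union>z\<in>Z. {p \<in> Bad. I p \<inter> N z \<noteq> {}})"
  proof
    fix p assume "p \<in> Bad"
    then obtain w where "w \<in> I p"
      using nonempty[of p] by (auto simp: Bad_def)
    then show "p \<in> (\<Union>z\<in>Z. {p \<in> Bad. I p \<inter> N z \<noteq> {}})"
      using Z(2) \<open>p \<in> Bad\<close> by blast
  qed
  then show ?thesis
    unfolding Bad_def[symmetric] using Z(1) N by (auto intro: finite_subset)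
qed

text \<open>
  The intervals span the convex components of \<open>U m\<close> minus the first \<open>m\<close> points of a countable dense set
  \<open>D\<close>, where the open sets \<open>U m\<close> decrease to \<open>C\<close>.  Removing dense points cuts the components down until
  continuous functions hardly vary over them; the only other way for components to stay long is to hug a
  jump, and its two sides are not internal and so are expelled by the sets \<open>U m\<close>.  A point of \<open>C\<close>
  outside \<open>D\<close> lies inside one component for every \<open>m\<close>.
\<close>

lemma null_sequence_of_intervals:
  fixes C :: "'l::linorder_topology set"
  assumes compact: "compact (UNIV :: 'l set)" and separable: "separable_space (euclidean :: 'l topology)"
    and gdelta: "gdelta_in euclidean C" and internal: "\<And>x. x \<in> C \<Longrightarrow> internal_point x"
  shows "\<exists>D (x :: nat \<Rightarrow> 'l) y. countable D \<and>
    (\<forall>f :: 'l \<Rightarrow> real. continuous_on UNIV f \<longrightarrow> (\<lambda>n. f (x n) - f (y n)) \<longlonglongrightarrow> 0) \<and>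
    (\<forall>t\<in>C - D. \<exists>\<^sub>\<infinity>n. x n < t \<and> t < y n)"
proof -
  obtain D :: "'l set" where D: "countable D" "closure D = UNIV"
    using separable unfolding separable_space_def by auto
  define d where "d = from_nat_into D"
  have "D \<noteq> {}"
    using D(2) by auto
  then have range_d: "range d = D"
    unfolding d_def using D(1) by (rule range_from_nat_into)
  have dense: "\<exists>k. d k \<in> S" if "open S" "S \<noteq> {}" for S
    using that D(2) open_Int_closure_eq_empty[of S D] range_d by blast
  have "\<exists>U. (\<forall>n. open (U n)) \<and> (\<forall>n. U (Suc n) \<subseteq> U n) \<and> \<Inter>(range U) = C"
    using gdelta by (simp add: gdelta_in_descending)
  then obtain U where U: "\<And>n. open (U n)" "\<And>n. U (Suc n) \<subseteq> U n" "\<Inter>(range U) = C"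
    by blast
  have escape: "\<exists>m0. \<forall>m\<ge>m0. z \<notin> U m" if z: "\<not> internal_point z" for z
  proof -
    have "z \<notin> \<Inter>(range U)"
      using U(3) internal z by blast
    then obtain m0 where "z \<notin> U m0"
      by blast
    then show ?thesis
      using lift_Suc_antimono_le[of U, OF U(2)] by (metis in_mono)
  qed
  define W where "W m = U m - d ` {..<m}" for m
  have "open (W m)" for m
    unfolding W_def by (intro open_Diff U finite_imp_closed) auto
  define I where "I = (\<lambda>(m, k). order_component (W m) (d k))"
  \<comment> \<open>Every component is listed once, under the first dense point that it contains.\<close>
  define P where "P = {(m, k). d k \<in> W m \<and> (\<forall>j<k. d j \<notin> I (m, k))}"
  have self: "d k \<in> I (m, k)" if "(m, k) \<in> P" for m k
    using that by (auto simp: P_def I_def order_component_def)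
  then have nonempty: "I p \<noteq> {}" if "p \<in> P" for p
    using that by (cases p) auto
  have sub: "I (m, k) \<subseteq> U m - d ` {..<m}" for m k
    using order_component_subset[of "W m" "d k"] by (simp add: I_def W_def)
  have convex: "w \<in> I p" if "r \<in> I p" "s \<in> I p" "r \<le> w" "w \<le> s" for p r s w
    using order_component_convex that unfolding I_def by (cases p) auto
  have disj: "k = k'" if "(m, k) \<in> P" "(m, k') \<in> P" "w \<in> I (m, k)" "w \<in> I (m, k')" for m k k' w
  proof -
    have "d k \<in> I (m, k')" "d k' \<in> I (m, k)"
      using that(3,4) order_component_sym order_component_trans unfolding I_def by fast+
    then show ?thesis
      using that(1,2) unfolding P_def by (metis (no_types, lifting) case_prodD mem_Collect_eq neqE)
  qed
  obtain lo' where lo': "\<And>p. p \<in> P \<Longrightarrow> (\<forall>x\<in>I p. lo' p \<le> x) \<and> (\<forall>u. (\<forall>x\<in>I p. u \<le> x) \<longrightarrow> u \<le> lo' p)"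
    using compact_line_has_inf[OF compact nonempty] by metis
  obtain hi' where hi': "\<And>p. p \<in> P \<Longrightarrow> (\<forall>x\<in>I p. x \<le> hi' p) \<and> (\<forall>u. (\<forall>x\<in>I p. x \<le> u) \<longrightarrow> hi' p \<le> u)"
    using compact_line_has_sup[OF compact nonempty] by metis
  define lo where "lo p = (if p \<in> P then lo' p else d 0)" for p
  define hi where "hi p = (if p \<in> P then hi' p else d 0)" for p
  have ends: "lo p \<in> {u..v} \<and> hi p \<in> {u..v}" if "p \<in> P" "I p \<subseteq> {u..v}" for p u v
  proof -
    obtain w where "w \<in> I p"
      using nonempty \<open>p \<in> P\<close> by blast
    moreover have "\<forall>x\<in>I p. u \<le> x" "\<forall>x\<in>I p. x \<le> v"
      using that(2) by auto
    ultimately have "u \<le> lo p" "lo p \<le> w" "w \<le> hi p" "hi p \<le> v"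
      using lo'[OF that(1)] hi'[OF that(1)] that(1) by (simp_all add: lo_def hi_def)
    then show ?thesis
      by auto
  qed
  have fin: "finite {p. e \<le> \<bar>f (lo p) - f (hi p)\<bar>}" if "continuous_on UNIV f" "e > 0" 
    for f :: "'l \<Rightarrow> real" and e
  proof -
    have "finite {p \<in> P. e \<le> \<bar>f (lo p) - f (hi p)\<bar>}"
      by (rule finite_large_oscillations[of d U P I lo hi f e, OF compact dense escape nonempty sub convex disj ends that])
    moreover have "{p. e \<le> \<bar>f (lo p) - f (hi p)\<bar>} \<subseteq> {p \<in> P. e \<le> \<bar>f (lo p) - f (hi p)\<bar>}"
      using \<open>e > 0\<close> by (auto simp: lo_def hi_def)
    ultimately show ?thesis
      using finite_subset by blast
  qed
  define x where "x n = lo (prod_decode n)" for n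
  define y where "y n = hi (prod_decode n)" for n
  show ?thesis
  proof (rule exI[of _ D], rule exI[of _ x], rule exI[of _ y], intro conjI D(1) allI impI ballI)
    fix f :: "'l \<Rightarrow> real" assume f: "continuous_on UNIV f"
    show "(\<lambda>n. f (x n) - f (y n)) \<longlonglongrightarrow> 0"
    proof (rule tendstoI)
      fix e :: real assume "e > 0"
      have "finite (prod_decode -` {p. e \<le> \<bar>f (lo p) - f (hi p)\<bar>})"
        by (intro finite_vimageI fin f \<open>e > 0\<close> inj_prod_decode)
      then have "finite {n. \<not> dist (f (x n) - f (y n)) 0 < e}"
        by (simp add: vimage_def x_def y_def not_less)
      then show "\<forall>\<^sub>F n in sequentially. dist (f (x n) - f (y n)) 0 < e"
        by (simp flip: cofinite_eq_sequentially add: eventually_cofinite)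
    qed
  next
    fix t assume t: "t \<in> C - D"
    have "\<exists>k. lo (m, k) < t \<and> t < hi (m, k)" for m
    proof -
      have "t \<in> W m"
        using t U(3) range_d by (auto simp: W_def)
      then obtain p q where pq: "p < t" "t < q" "{p..q} \<subseteq> W m"
        using internal_point_interval[OF internal \<open>open (W m)\<close>] t by blast
      have comp: "s \<in> order_component (W m) t" if "p \<le> s" "s \<le> q" for s
      proof -
        have "{min s t..max s t} \<subseteq> {p..q}"
          using pq(1,2) that by (auto simp: min_def max_def split: if_splits)
        then show ?thesis
          using pq(3) unfolding order_component_def by blast
      qed
      have "\<exists>k. d k \<in> order_component (W m) t"
        using dense[of "{p<..<q}"] pq comp by (metis greaterThanLessThan_iff less_imp_le open_greaterThanLessThan empty_iff)
      then obtain k where k: "d k \<in> order_component (W m) t" and least: "\<And>j. j < k \<Longrightarrow> d j \<notin> order_component (W m) t"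
        using exists_least_iff[of "\<lambda>k. d k \<in> order_component (W m) t"] by blast
      have "I (m, k) = order_component (W m) t"
        using k order_component_sym order_component_trans unfolding I_def by fast
      moreover have "d k \<in> W m"
        using k order_component_subset by blast
      ultimately have P: "(m, k) \<in> P" and I: "p \<in> I (m, k)" "q \<in> I (m, k)"
        using least comp pq(1,2) by (auto simp: P_def)
      have "lo (m, k) \<le> p" "q \<le> hi (m, k)"
        using lo'[OF P] hi'[OF P] I P by (auto simp: lo_def hi_def)
      then show ?thesis
        using pq(1,2) by (meson le_less_trans less_le_trans)
    qed
    then obtain k where k: "\<And>m. lo (m, k m) < t \<and> t < hi (m, k m)"
      by metis
    have "infinite (range (\<lambda>m. prod_encode (m, k m)))"
      by (rule range_inj_infinite) (simp add: inj_def)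
    moreover have "range (\<lambda>m. prod_encode (m, k m)) \<subseteq> {n. x n < t \<and> t < y n}"
      using k by (auto simp: x_def y_def)
    ultimately show "\<exists>\<^sub>\<infinity>n. x n < t \<and> t < y n"
      unfolding INFM_iff_infinite using infinite_super by blast
  qed
qed

context fibre_ends
begin

text \<open>
  On a pulled back continuous function that drops from \<open>1\<close> to \<open>0\<close> between \<open>x\<close> and \<open>y\<close> the
  functional has value \<open>1\<close>.  For \<open>t\<close> in the set, such a function dropping right after \<open>t\<close>
  differs from \<open>e t\<close>, whose value is less than a half, by a function supported between the fibre of
  \<open>t\<close> and that of the next point considered; so each \<open>t\<close> uses up at least a half of the total variation \<open>M\<close>.
\<close>

lemma finite_small_gap_values:
  assumes bf: "bounded_functional N M"
    and N: "\<And>g. continuous_on UNIV g \<Longrightarrow> N (\<lambda>z. g (\<phi> z)) = g x - g y"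
    and e_range: "\<And>t z. t \<in> Q \<phi> \<Longrightarrow> 0 \<le> e t z \<and> e t z \<le> (1 :: real)"
    and e_one: "\<And>t z. t \<in> Q \<phi> \<Longrightarrow> z \<le> a t \<Longrightarrow> e t z = 1"
    and e_zero: "\<And>t z. t \<in> Q \<phi> \<Longrightarrow> b t \<le> z \<Longrightarrow> e t z = 0"
  shows "finite {t \<in> Q \<phi>. x < t \<and> t < y \<and> \<bar>N (e t)\<bar> < 1 / 2}"
proof -
  interpret bounded_functional N M by (rule bf)
  have "card F \<le> nat \<lfloor>2 * M\<rfloor>" if F: "F \<subseteq> {t \<in> Q \<phi>. x < t \<and> t < y \<and> \<bar>N (e t)\<bar> < 1 / 2}" "finite F" for F
  proof -
    obtain g :: "'l \<Rightarrow> 'l \<Rightarrow> real" where cont: "\<And>t. continuous_on UNIV (g t)"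
      and range: "\<And>t x. 0 \<le> g t x \<and> g t x \<le> 1" and one: "\<And>t x. x \<le> t \<Longrightarrow> g t x = 1"
      and zero: "\<And>t s x. s \<in> insert y F \<Longrightarrow> t < s \<Longrightarrow> s \<le> x \<Longrightarrow> g t x = 0"
      using step_function[OF compact_L, of "insert y F"] F(2) by (metis finite_insert)
    define h where "h t z = g t (\<phi> z) - e t z" for t z
    have Q: "t \<in> Q \<phi>" if "t \<in> F" for t
      using F(1) that by blast
    have "1 / 2 \<le> \<bar>N (h t)\<bar>" if "t \<in> F" for t
    proof -
      have "bounded (range (\<lambda>z. g t (\<phi> z)))" "bounded (range (e t))"
        using range e_range[OF Q[OF that]] by (auto simp: bounded_iff intro!: exI[of _ 1])
      then have "N (h t) = N (\<lambda>z. g t (\<phi> z)) - N (e t)"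
        unfolding h_def by (rule diff)
      moreover have "N (\<lambda>z. g t (\<phi> z)) = 1"
        using N[OF cont] one[of x t] zero[of y t y] F(1) that by auto
      moreover have "\<bar>N (e t)\<bar> < 1 / 2"
        using F(1) that by blast
      ultimately show ?thesis
        by linarith
    qed
    then have "card F * (1 / 2) \<le> (\<Sum>t\<in>F. \<bar>N (h t)\<bar>)"
      by (rule sum_bounded_below)
    also have "\<dots> \<le> M"
    proof (rule sum_abs_disjoint_le[OF F(2)])
      show "\<bar>h t z\<bar> \<le> 1" if "t \<in> F" for t z
        using range[of t "\<phi> z"] e_range[OF Q[OF that], of z] by (simp add: h_def abs_le_iff)
      have above: "t \<le> \<phi> z" if "t \<in> F" "h t z \<noteq> 0" for t z
      proof (rule ccontr)
        assume "\<not> t \<le> \<phi> z"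
        then have "b (\<phi> z) < a t"
          by (intro b_less_a) simp
        then have "z \<le> a t"
          using le_b[of z] by simp
        then show False
          using that e_one[OF Q[OF that(1)]] one[of "\<phi> z" t] \<open>\<not> t \<le> \<phi> z\<close> by (simp add: h_def)
      qed
      have below: "\<phi> z < s" if "t \<in> F" "s \<in> F" "t < s" "h t z \<noteq> 0" for t s z
      proof (rule ccontr)
        assume "\<not> \<phi> z < s"
        then have "b t < a (\<phi> z)"
          using that(3) by (intro b_less_a) simp
        then have "b t \<le> z"
          using a_le[of z] by simp
        then show False
          using that e_zero[OF Q[OF that(1)]] zero[of s t "\<phi> z"] \<open>\<not> \<phi> z < s\<close> by (simp add: h_def)
      qed
      show "h s z = 0 \<or> h t z = 0" if "s \<in> F" "t \<in> F" "s \<noteq> t" for s t z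
        using that above below by (metis neqE not_le)
    qed
    finally show ?thesis
      by (simp add: le_nat_floor)
  qed
  then show ?thesis
    by (intro conjunct1[OF finite_if_finite_subsets_card_bdd])
qed

text \<open>
  Differences of evaluations along a null sequence of intervals give an operator into \<open>c0\<close>.  If it extends,
  then on a continuous function \<open>e t\<close> dropping within the fibre of \<open>t\<close> the extended functionals are
  eventually small, while infinitely many of the intervals contain \<open>t\<close>; so \<open>t\<close> belongs to one of
  countably many finite sets.
\<close>

lemma countable_if_c0_extension:
  assumes ext: "has_c0_extension_property \<phi>" and separable: "separable_space (euclidean :: 'l topology)"
    and "gdelta_in euclidean C" "\<forall>x\<in>C. internal_point x"
  shows "countable (C \<inter> Q \<phi>)"
proof -
  have "\<exists>D (x :: nat \<Rightarrow> 'l) y. countable D \<and>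
    (\<forall>f :: 'l \<Rightarrow> real. continuous_on UNIV f \<longrightarrow> (\<lambda>n. f (x n) - f (y n)) \<longlonglongrightarrow> 0) \<and>
    (\<forall>t\<in>C - D. \<exists>\<^sub>\<infinity>n. x n < t \<and> t < y n)"
    using assms(4) by (intro null_sequence_of_intervals[OF compact_L separable assms(3)]) simp
  then obtain D and x y :: "nat \<Rightarrow> 'l" where D: "countable D"
    and null: "\<And>f :: 'l \<Rightarrow> real. continuous_on UNIV f \<Longrightarrow> (\<lambda>n. f (x n) - f (y n)) \<longlonglongrightarrow> 0"
    and inf: "\<And>t. t \<in> C - D \<Longrightarrow> \<exists>\<^sub>\<infinity>n. x n < t \<and> t < y n"
    by blast
  define T where "T n h = apply_bcontfun h (a (x n)) - apply_bcontfun h (a (y n))" for n and h :: "'k \<Rightarrow>\<^sub>C real"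
  have lin: "linear (T n)" for n
    by (rule linearI) (simp_all add: T_def algebra_simps)
  have bound: "\<bar>T n h\<bar> \<le> 2 * norm h" for n h
    using norm_bounded[of h "a (x n)"] norm_bounded[of h "a (y n)"] by (simp add: T_def)
  have T_null: "(\<lambda>n. T n h) \<longlonglongrightarrow> 0" if "h \<in> range (pullback \<phi>)" for h
    using that null by (auto simp: T_def apply_pullback[OF cont])
  have T_op: "bounded_operator_on (range (pullback \<phi>)) c0 (\<lambda>h. Bcontfun (\<lambda>n. T n h))"
    by (rule bounded_operator_on_c0I(1)[OF lin bound T_null])
  have "\<exists>S. bounded_operator_on UNIV c0 S \<and> (\<forall>h\<in>range (pullback \<phi>). S h = Bcontfun (\<lambda>n. T n h))"
    using ext[unfolded has_c0_extension_property_def c0_extension_property_in_def, rule_format, OF T_op] .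
  then obtain S where S: "bounded_operator_on UNIV c0 S"
    and S_T: "\<And>h. h \<in> range (pullback \<phi>) \<Longrightarrow> S h = Bcontfun (\<lambda>n. T n h)"
    by blast
  obtain M N where bf: "\<And>n. bounded_functional (N n) M"
    and N_S: "\<And>n f. N n (apply_bcontfun f) = apply_bcontfun (S f) n"
    and N_null: "\<And>g. continuous_on UNIV g \<Longrightarrow> bounded (range g) \<Longrightarrow> (\<lambda>n. N n g) \<longlonglongrightarrow> 0"
    using c0_operator_functionals[OF S] by metis
  have N: "N n (\<lambda>z. g (\<phi> z)) = g (x n) - g (y n)" if g: "continuous_on UNIV g" for n g
  proof -
    have "bounded (range g)"
      using compact_continuous_image[OF g compact_L] by (rule compact_imp_bounded)
    then have app: "apply_bcontfun (Bcontfun g) = g"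
      using g by (intro Bcontfun_inverse) (simp add: bcontfun_def)
    have "N n (\<lambda>z. g (\<phi> z)) = apply_bcontfun (S (pullback \<phi> (Bcontfun g))) n"
      using N_S[of n "pullback \<phi> (Bcontfun g)"] by (simp add: apply_pullback[OF cont] app o_def)
    also have "\<dots> = T n (pullback \<phi> (Bcontfun g))"
      using bounded_operator_on_c0I(2)[OF lin bound T_null] by (simp add: S_T)
    finally show ?thesis
      by (simp add: T_def apply_pullback[OF cont] app)
  qed
  define is_gap_function where "is_gap_function t e \<longleftrightarrow> continuous_on UNIV e \<and> (\<forall>z. 0 \<le> e z \<and> e z \<le> 1) \<and>
      (\<forall>z\<in>{..a t}. e z = 1) \<and> (\<forall>z\<in>{b t..}. e z = 0)" for t and e :: "'k \<Rightarrow> real"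
  define e where "e t = (SOME e. is_gap_function t e)" for t
  have e: "is_gap_function t (e t)" if "t \<in> Q \<phi>" for t
  proof -
    have "{..a t} \<inter> {b t..} = {}"
      using that Q_iff by auto
    then have "\<exists>e. is_gap_function t e"
      unfolding is_gap_function_def by (intro Urysohn_compact compact_K closed_atMost closed_atLeast)
    then show ?thesis
      unfolding e_def by (rule someI_ex)
  qed
  have e_range: "0 \<le> e t z \<and> e t z \<le> 1" if "t \<in> Q \<phi>" for t z
    using e[OF that] by (simp add: is_gap_function_def)
  define E where "E n = {t \<in> Q \<phi>. x n < t \<and> t < y n \<and> \<bar>N n (e t)\<bar> < 1 / 2}" for n
  have "finite (E n)" for n
    unfolding E_def
    by (rule finite_small_gap_values[OF bf N e_range]) (use e in \<open>auto simp: is_gap_function_def\<close>)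
  then have "countable (D \<union> (\<Union>n. E n))"
    using D by (simp add: countable_finite)
  moreover have "C \<inter> Q \<phi> \<subseteq> D \<union> (\<Union>n. E n)"
  proof
    fix t assume t: "t \<in> C \<inter> Q \<phi>"
    show "t \<in> D \<union> (\<Union>n. E n)"
    proof (cases "t \<in> D")
      case False
      have "bounded (range (e t))"
        using e_range[of t] t by (auto simp: bounded_iff intro!: exI[of _ 1])
      then have "(\<lambda>n. N n (e t)) \<longlonglongrightarrow> 0"
        using N_null e[of t] t by (simp add: is_gap_function_def)
      then have "\<forall>\<^sub>F n in sequentially. \<bar>N n (e t)\<bar> < 1 / 2"
        using tendstoD[of "\<lambda>n. N n (e t)" 0 sequentially "1 / 2"] by (simp add: dist_real_def)
      then obtain m where m: "\<And>n. n \<ge> m \<Longrightarrow> \<bar>N n (e t)\<bar> < 1 / 2"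
        by (auto simp: eventually_sequentially)
      obtain n where "n \<ge> m" "x n < t" "t < y n"
        using inf[of t] t False unfolding INFM_nat_le by blast
      then show ?thesis
        using m t by (auto simp: E_def)
    qed simp
  qed
  ultimately show ?thesis
    using countable_subset by blast
qed

end

lemma fibre_ends_exist:
  fixes \<phi> :: "'k::linorder_topology \<Rightarrow> 'l::linorder_topology"
  assumes "compact (UNIV :: 'k set)" "compact (UNIV :: 'l set)" "continuous_on UNIV \<phi>" "mono \<phi>" "surj \<phi>"
  shows "\<exists>a b. fibre_ends \<phi> a b"
proof -
  have fibre: "compact (\<phi> -` {t})" "\<phi> -` {t} \<noteq> {}" for t
  proof -
    have "closed (\<phi> -` {t})"
      by (rule closed_vimage[OF closed_singleton assms(3)])
    then show "compact (\<phi> -` {t})"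
      using compact_Int_closed[OF assms(1), of "\<phi> -` {t}"] by simp
    obtain x where "t = \<phi> x"
      by (rule surjE[OF \<open>surj \<phi>\<close>])
    then show "\<phi> -` {t} \<noteq> {}"
      by blast
  qed
  have inf: "\<exists>u. u \<in> \<phi> -` {t} \<and> (\<forall>x\<in>\<phi> -` {t}. u \<le> x)" for t
    using compact_attains_inf[OF fibre, of t] by blast
  have sup: "\<exists>u. u \<in> \<phi> -` {t} \<and> (\<forall>x\<in>\<phi> -` {t}. x \<le> u)" for t
    using compact_attains_sup[OF fibre, of t] by blast
  define a where "a t = (SOME u. u \<in> \<phi> -` {t} \<and> (\<forall>x\<in>\<phi> -` {t}. u \<le> x))" for t
  define b where "b t = (SOME u. u \<in> \<phi> -` {t} \<and> (\<forall>x\<in>\<phi> -` {t}. x \<le> u))" for t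
  have a: "a t \<in> \<phi> -` {t} \<and> (\<forall>x\<in>\<phi> -` {t}. a t \<le> x)" for t
    unfolding a_def by (rule someI_ex[OF inf])
  have b: "b t \<in> \<phi> -` {t} \<and> (\<forall>x\<in>\<phi> -` {t}. x \<le> b t)" for t
    unfolding b_def by (rule someI_ex[OF sup])
  have "fibre_ends \<phi> a b"
    using assms a b by (intro fibre_ends.intro) simp_all
  then show ?thesis by blast
qed

theorem theorem3p1:
  fixes \<phi> :: "'k::linorder_topology \<Rightarrow> 'l::linorder_topology"
  assumes "compact (UNIV :: 'k set)"
    and "compact (UNIV :: 'l set)"
    and "separable_space (euclidean :: 'l topology)"
    and "continuous_on UNIV \<phi>"
    and "mono \<phi>"
    and "surj \<phi>"
  shows "has_c0_extension_property \<phi> \<longleftrightarrow>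
    (\<forall>C. gdelta_in euclidean C \<and> (\<forall>x\<in>C. internal_point x) \<longrightarrow>
      C \<inter> Q \<phi> = C \<inter> Q0 \<phi> \<and> countable (C \<inter> Q \<phi>))"
proof -
  obtain a b where "fibre_ends \<phi> a b"
    using fibre_ends_exist[OF assms(1,2,4,5,6)] by blast
  then interpret fibre_ends \<phi> a b .
  have eq: "C \<inter> Q \<phi> = C \<inter> Q0 \<phi>" if "\<forall>x\<in>C. internal_point x" for C
    using that by (auto simp: Q0_def)
  show ?thesis
  proof
    assume "has_c0_extension_property \<phi>"
    then show "\<forall>C. gdelta_in euclidean C \<and> (\<forall>x\<in>C. internal_point x) \<longrightarrow>
        C \<inter> Q \<phi> = C \<inter> Q0 \<phi> \<and> countable (C \<inter> Q \<phi>)"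
      using countable_if_c0_extension[OF _ assms(3)] eq by simp
  next
    assume "\<forall>C. gdelta_in euclidean C \<and> (\<forall>x\<in>C. internal_point x) \<longrightarrow>
        C \<inter> Q \<phi> = C \<inter> Q0 \<phi> \<and> countable (C \<inter> Q \<phi>)"
    then show "has_c0_extension_property \<phi>"
      by (intro c0_extension_if_countable) blast
  qed
qed

end
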